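(* Let $(F_n)_{n\ge0}$ and $(L_n)_{n\ge0}$ be the Fibonacci and Lucas sequences. For integers $2\le b\le 10$, consider the equation $$L_n = L_m\cdot b^d + F_k$$ in non-negative integers $n,m,k$, where $d$ is the number of digits of $F_k$ written in base $b$. Then the only solutions $(n,m,k,b,d)$ are: - $b=2$: $(0,1,0,2,1)$, $(2,1,1,2,1)$, $(2,1,2,2,1)$, $(3,0,0,2,1)$, $(4,1,4,2,2)$, $(4,2,1,2,1)$, $(4,2,2,2,1)$, $(5,0,4,2,2)$, $(6,3,3,2,2)$, $(7,1,7,2,4)$, $(7,2,5,2,3)$, $(8,5,4,2,2)$; - $b=3$: $(2,1,0,3,1)$, $(3,1,1,3,1)$, $(3,1,2,3,1)$, $(4,0,1,3,1)$, $(4,0,2,3,1)$, $(5,2,3,3,1)$; - $b=4$: $(3,1,0,4,1)$, $(4,1,4,4,1)$, $(5,0,4,4,1)$, $(6,3,3,4,1)$, $(7,1,7,4,2)$, $(7,4,1,4,1)$, $(7,4,2,4,1)$, $(8,5,4,4,1)$; - $b=5$: $(4,1,3,5,1)$, $(5,0,1,5,1)$, $(5,0,2,5,1)$, $(6,2,4,5,1)$; - $b=6$: $(4,1,1,6,1)$, $(4,1,2,6,1)$, $(5,1,5,6,1)$, $(6,2,0,6,1)$, $(7,3,5,6,1)$, $(8,4,5,6,1)$, $(13,0,11,6,3)$; - $b=7$: $(4,1,0,7,1)$, $(7,3,1,7,1)$, $(7,3,2,7,1)$; - $b=8$: $(5,1,4,8,1)$, $(6,0,3,8,1)$, $(7,2,5,8,1)$;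 - $b=9$: $(5,1,3,9,1)$, $(6,0,0,9,1)$, $(7,2,3,9,1)$; - $b=10$: $(5,1,1,10,1)$, $(5,1,2,10,1)$, $(6,1,6,10,1)$. In particular, for $b=10$ the only Lucas numbers satisfying the equation are $L_5 = 10\cdot L_1 + F_1 = 10\cdot L_1+F_2 = 11$ and $L_6 = 10\cdot L_1 + F_6 = 18$.
   Context: $F_0=0$, $F_1=1$, $F_{n+2}=F_{n+1}+F_n$; $L_0=2$, $L_1=1$, $L_{n+2}=L_{n+1}+L_n$. The number of base-$b$ digits of a positive integer $N$ is $\lfloor \log_b N\rfloor+1$; the number $0$ is regarded as having one digit (as the listed solutions with $k=0$, $d=1$ indicate). *)

theory Defs
  imports "HOL-Number_Theory.Fib" Complex_Main
begin

fun lucas :: "nat \<Rightarrow> nat" where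
  "lucas 0 = 2"
| "lucas (Suc 0) = 1"
| "lucas (Suc (Suc n)) = lucas (Suc n) + lucas n"

definition num_digits :: "nat \<Rightarrow> nat \<Rightarrow> nat" where
  "num_digits b N = (if N = 0 then 1 else nat \<lfloor>log (real b) (real N)\<rfloor> + 1)"

definition sols :: "(nat \<times> nat \<times> nat \<times> nat \<times> nat) set" where
  "sols = {
   (0,1,0,2,1), (2,1,1,2,1), (2,1,2,2,1), (3,0,0,2,1), (4,1,4,2,2), (4,2,1,2,1),
   (4,2,2,2,1), (5,0,4,2,2), (6,3,3,2,2), (7,1,7,2,4), (7,2,5,2,3), (8,5,4,2,2),
   (2,1,0,3,1), (3,1,1,3,1), (3,1,2,3,1), (4,0,1,3,1), (4,0,2,3,1), (5,2,3,3,1),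
   (3,1,0,4,1), (4,1,4,4,1), (5,0,4,4,1), (6,3,3,4,1), (7,1,7,4,2), (7,4,1,4,1),
   (7,4,2,4,1), (8,5,4,4,1),
   (4,1,3,5,1), (5,0,1,5,1), (5,0,2,5,1), (6,2,4,5,1),
   (4,1,1,6,1), (4,1,2,6,1), (5,1,5,6,1), (6,2,0,6,1), (7,3,5,6,1), (8,4,5,6,1),
   (13,0,11,6,3),
   (4,1,0,7,1), (7,3,1,7,1), (7,3,2,7,1),
   (5,1,4,8,1), (6,0,3,8,1), (7,2,5,8,1),
   (5,1,3,9,1), (6,0,0,9,1), (7,2,3,9,1),
   (5,1,1,10,1), (5,1,2,10,1), (6,1,6,10,1)}"

end

theory Submission
  imports Defs "HOL-Number_Theory.Residues"
begin

text \<open>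
  The digit condition says \<open>F\<^sub>k < b\<^sup>d \<le> b F\<^sub>k\<close>, so \<open>n - m - k\<close> is confined to a short interval. For
  \<open>m \<ge> 10\<close>, reducing \<open>L\<^sub>n \<equiv> F\<^sub>k\<close> modulo \<open>L\<^sub>m\<close> (where \<open>k\<close> matters only modulo \<open>2m\<close>, up to sign)
  forces \<open>k = 2mq\<close> and \<open>n = k + m\<close>. If \<open>q\<close> and \<open>d\<close> are both even, then \<open>N = mq\<close> satisfies
  \<open>L\<^sub>m (b\<^sup>d + 1) = L\<^sub>N (L\<^bsub>N+m\<^esub> - F\<^sub>N)\<close>, so a prime \<open>\<equiv> 3 (mod 4)\<close> dividing some \<open>L\<^bsub>2^a\<^esub>\<close> divides
  a square plus one, which is impossible. Every other class of \<open>(m, q, d)\<close> is excluded by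
  finitely many congruences: the two sides are compared modulo small prime powers, splitting
  residue classes step by step. For \<open>m < 10\<close> the same sieve, now in \<open>(k, d)\<close> for each of the finitely
  many pairs \<open>(m, n - k)\<close>, excludes all \<open>k \<ge> 20\<close>, and a finite search remains. The bases
  4, 8 and 9 are treated as powers of 2 and 3.
\<close>

subsection \<open>Fibonacci and Lucas identities\<close>

abbreviation fibi :: "nat \<Rightarrow> int" where "fibi n \<equiv> int (fib n)"
abbreviation luci :: "nat \<Rightarrow> int" where "luci n \<equiv> int (lucas n)"

lemma fibi_Suc_Suc: "fibi (Suc (Suc n)) = fibi (Suc n) + fibi n"
  by simp

lemma luci_fibi: "luci n = 2 * fibi (Suc n) - fibi n"
  by (induction n rule: lucas.induct) (simp_all add: algebra_simps)

lemma fibi_add: "fibi (Suc (n + k)) = fibi (Suc n) * fibi (Suc k) + fibi n * fibi k"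
  by (induction n arbitrary: k rule: fib.induct)
     (simp_all add: algebra_simps fib_add)

text \<open>The difference F_{n+1} - F_n stands for F_{n-1}, so no index is lowered and n = 0 is
  included.\<close>

lemma fibi_add': "fibi (n + k) = fibi n * fibi (Suc k) + (fibi (Suc n) - fibi n) * fibi k"
proof (cases n)
  case (Suc l)
  then show ?thesis using fibi_add[of l k] by (simp add: algebra_simps)
qed simp

lemma luci_add: "luci (n + k) = luci n * fibi (Suc k) + (luci (Suc n) - luci n) * fibi k"
  using fibi_add[of n k] fibi_add'[of n k] by (simp add: luci_fibi algebra_simps)

lemma fibi_cassini: "(-1) ^ n = fibi (Suc n) * fibi (Suc n) - fibi n * fibi (Suc n) - fibi n * fibi n"
  by (induction n) (simp_all add: algebra_simps)

text \<open>This is Cayley-Hamilton for the m-th power of the Fibonacci matrix, which has trace L_m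
  and determinant (-1)^m. Modulo L_m, a shift of the index by 2m is therefore multiplication by a
  sign.\<close>

lemma fibi_double_add: "fibi (2 * m + s) = luci m * fibi (m + s) - (-1) ^ m * fibi s"
proof -
  let ?a = "fibi m" and ?b = "fibi (Suc m)" and ?c = "fibi s" and ?d = "fibi (Suc s)"
  have "2 * m + s = m + (m + s)" by simp
  then have "fibi (2 * m + s) = ?a * (?b * ?d + ?a * ?c) + (?b - ?a) * (?a * ?d + (?b - ?a) * ?c)"
    by (simp only: fibi_add'[of m "m + s"] fibi_add[of m s] fibi_add'[of m s])
  also have "\<dots> = (2 * ?b - ?a) * (?a * ?d + (?b - ?a) * ?c) - (?b * ?b - ?a * ?b - ?a * ?a) * ?c"
    by (simp add: algebra_simps)
  also have "\<dots> = luci m * fibi (m + s) - (-1) ^ m * fibi s"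
    by (simp only: luci_fibi[of m] fibi_add'[of m s] fibi_cassini[of m])
  finally show ?thesis .
qed

lemma luci_double_add: "luci (2 * m + s) = luci m * luci (m + s) - (-1) ^ m * luci s"
  using fibi_double_add[of m s] fibi_double_add[of m "Suc s"]
  unfolding luci_fibi[of "2 * m + s"] luci_fibi[of "m + s"] luci_fibi[of s]
  by (simp add: algebra_simps del: fib.simps)

text \<open>The instance 2t + (m - t) = m + t of \<open>luci_double_add\<close>. It folds an index
  above m back below m, modulo L_m.\<close>

lemma luci_reflect:
  assumes "t \<le> m"
  shows "luci (m + t) = luci m * luci t - (-1) ^ t * luci (m - t)"
  using luci_double_add[of t "m - t"] assms by (simp add: algebra_simps mult_2)

text \<open>\<open>fibi_double_add\<close> with doubled index t would give the product L_t F_m. Here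
  L_m has to be the factor, so everything is expanded by the addition formulas and Cassini's
  identity supplies the sign.\<close>

lemma fibi_reflect:
  assumes "t \<le> m"
  shows "fibi (m + t) = luci m * fibi t + (-1) ^ t * fibi (m - t)"
proof -
  obtain s where m: "m = t + s" using assms le_iff_add by blast
  let ?a = "fibi t" and ?b = "fibi (Suc t)" and ?c = "fibi s" and ?d = "fibi (Suc s)"
  have "m + t = t + (t + s)" by (simp add: m)
  then have "fibi (m + t) = ?a * (?b * ?d + ?a * ?c) + (?b - ?a) * (?a * ?d + (?b - ?a) * ?c)"
    by (simp only: fibi_add'[of t "t + s"] fibi_add[of t s] fibi_add'[of t s])
  also have "\<dots> = (2 * (?b * ?d + ?a * ?c) - (?a * ?d + (?b - ?a) * ?c)) * ?a
      + (?b * ?b - ?a * ?b - ?a * ?a) * ?c"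
    by (simp add: algebra_simps)
  also have "\<dots> = luci m * fibi t + (-1) ^ t * fibi (m - t)"
    by (simp only: m luci_fibi[of "t + s"] fibi_add[of t s] fibi_add'[of t s] fibi_cassini[of t]
      add_diff_cancel_left')
  finally show ?thesis .
qed

lemma luci_sq: "luci n * luci n - 5 * (fibi n * fibi n) = 4 * (-1) ^ n"
  unfolding luci_fibi fibi_cassini by (simp add: algebra_simps)

lemma fibi_double: "fibi (2 * n) = luci n * fibi n"
  using fibi_double_add[of n 0] by simp

lemma lucas_pos: "0 < lucas n"
  by (induction n rule: lucas.induct) auto

lemma lucas_less_Suc: "1 \<le> n \<Longrightarrow> lucas n < lucas (Suc n)"
proof (cases n)
  case (Suc l)
  then show ?thesis using lucas_pos[of l] by simp
qed simp

lemma lucas_mono: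
  assumes "1 \<le> n" "n \<le> n'"
  shows "lucas n \<le> lucas n'"
  using assms(2)
proof (induction n' rule: dec_induct)
  case (step l)
  then show ?case using lucas_less_Suc[of l] assms(1) by linarith
qed simp_all

lemma lucas_mono': "n \<le> n' \<Longrightarrow> 2 \<le> n' \<Longrightarrow> lucas n \<le> lucas n'"
proof (cases "n = 0")
  case True
  assume "2 \<le> n'"
  then have "lucas 2 \<le> lucas n'" by (intro lucas_mono) auto
  then show ?thesis using True by (simp add: numeral_eq_Suc)
qed (auto intro: lucas_mono)

lemma lucas_less_imp: "lucas n < lucas n' \<Longrightarrow> 2 \<le> n \<Longrightarrow> n < n'"
  using lucas_mono'[of n' n] by (metis leD leI)

lemma lucas_as_fib: "lucas (Suc n) = fib (Suc (Suc n)) + fib n"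
  using luci_fibi[of "Suc n"] by simp

text \<open>For a >= 3, L_a = F_{a+1} + F_{a-1} lies strictly between F_{a+1} and F_{a+2} = F_{a+1}
  + F_a. For a <= 2, L_a <= 3 < F_5.\<close>

lemma lucas_eq_fib:
  assumes "lucas a = fib r"
  shows "a \<le> 2 \<and> r \<le> 4"
proof (rule ccontr)
  assume *: "\<not> (a \<le> 2 \<and> r \<le> 4)"
  show False
  proof (cases "a \<le> 2")
    case True
    then have "a \<in> {0, 1, 2}" by auto
    then have "lucas a \<le> 3" by (auto simp: numeral_eq_Suc)
    moreover have "fib 5 \<le> fib r" using True * by (intro fib_mono) auto
    ultimately show False using assms by (simp add: numeral_eq_Suc)
  next
    case False
    then obtain i where a: "a = Suc (Suc (Suc i))"
      by (metis add_2_eq_Suc' less_eq_Suc_le less_imp_Suc_add not_le add_Suc numeral_2_eq_2)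
    have l: "lucas a = fib (Suc a) + fib (Suc (Suc i))"
      using lucas_as_fib[of "Suc (Suc i)"] by (simp add: a)
    have p: "0 < fib (Suc i)" by (simp add: fib_neq_0_nat)
    have "fib (Suc a) < fib r" using l assms by (simp add: fib_neq_0_nat)
    then have "Suc a < r" using fib_mono by (metis leD leI)
    then have "fib (Suc (Suc a)) \<le> fib r" by (intro fib_mono) auto
    moreover have "fib (Suc (Suc a)) = fib (Suc a) + fib (Suc (Suc i)) + fib (Suc i)"
      by (simp add: a)
    ultimately show False using l assms p by linarith
  qed
qed

text \<open>Modulo L_m, raising an index by 2m multiplies both sequences by the same unit -(-1)^m,
  which does not affect divisibility.\<close>

lemma cong_sub_period:
  "luci m dvd luci (2 * m * q + s) - fibi (2 * m * q + r) \<longleftrightarrow> luci m dvd luci s - fibi r"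
proof (induction q)
  case (Suc q)
  have "2 * m * Suc q + s = 2 * m + (2 * m * q + s)" "2 * m * Suc q + r = 2 * m + (2 * m * q + r)"
    by simp_all
  then have eq: "luci (2 * m * Suc q + s) - fibi (2 * m * Suc q + r)
      = luci m * (luci (m + (2 * m * q + s)) - fibi (m + (2 * m * q + r)))
        + (- ((-1) ^ m)) * (luci (2 * m * q + s) - fibi (2 * m * q + r))"
    by (simp only: luci_double_add fibi_double_add) (simp add: algebra_simps)
  have "luci m dvd luci (2 * m * Suc q + s) - fibi (2 * m * Suc q + r)
      \<longleftrightarrow> luci m dvd (- ((-1) ^ m)) * (luci (2 * m * q + s) - fibi (2 * m * q + r))"
    unfolding eq by (rule dvd_add_right_iff) simp
  also have "\<dots> \<longleftrightarrow> luci m dvd luci (2 * m * q + s) - fibi (2 * m * q + r)"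
    by (cases "even m") (auto simp: dvd_diff_commute)
  finally show ?case using Suc.IH by simp
qed simp

lemma not_dvd_small:
  fixes a b c e :: int
  assumes "c dvd e * a - b" "e = 1 \<or> e = -1" "\<bar>a\<bar> + \<bar>b\<bar> < c"
  shows "\<bar>a\<bar> = \<bar>b\<bar>"
proof -
  have "e * a - b = 0"
  proof (rule ccontr)
    assume "e * a - b \<noteq> 0"
    then have "\<bar>c\<bar> \<le> \<bar>e * a - b\<bar>" using assms(1) by (rule dvd_imp_le_int)
    then show False using assms(2,3) by auto
  qed
  then show ?thesis using assms(2) by auto
qed

subsection \<open>The sieve\<close>

definition fibpair :: "int \<Rightarrow> nat \<Rightarrow> int \<times> int" where
  "fibpair M n = (fibi n mod M, fibi (Suc n) mod M)"

text \<open>Fast doubling: the pair at 2h or 2h + 1 comes from the pair at h. The index is an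
  \<open>int\<close>, so that evaluation halves a binary numeral instead of a successor
  term.\<close>

function fib_dbl :: "int \<Rightarrow> int \<Rightarrow> int \<times> int" where
  "fib_dbl M i = (if i \<le> 0 then (0, 1) else
     (case fib_dbl M (i div 2) of (a, b) \<Rightarrow>
       if i mod 2 = 0 then ((a * (2 * b - a)) mod M, (a * a + b * b) mod M)
       else ((a * a + b * b) mod M, (b * (2 * a + b)) mod M)))"
  by auto
termination by (relation "measure (\<lambda>(M, i). nat i)") auto

declare fib_dbl.simps [simp del]

lemma fib_dbl_eq:
  assumes "1 < M"
  shows "fib_dbl M (int n) = fibpair M n"
proof (induction n rule: less_induct)
  case (less n)
  show ?case
  proof (cases "n = 0")
    case True
    then show ?thesis using assms by (simp add: fibpair_def fib_dbl.simps)
  next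
    case False
    define h where "h = n div 2"
    have h: "fib_dbl M (int n div 2) = fibpair M h"
      using less[of h] False by (simp add: h_def zdiv_int)
    let ?a = "fibi h" and ?b = "fibi (Suc h)"
    have A: "fibi (h + h) = ?a * (2 * ?b - ?a)"
      using fibi_add'[of h h] by (simp add: algebra_simps)
    have B: "fibi (Suc (h + h)) = ?a * ?a + ?b * ?b"
      using fibi_add[of h h] by (simp add: algebra_simps)
    have C: "fibi (Suc (Suc (h + h))) = ?b * (2 * ?a + ?b)"
      using A B by (simp add: algebra_simps)
    have m: "(?a mod M * (2 * (?b mod M) - ?a mod M)) mod M = (?a * (2 * ?b - ?a)) mod M"
      "(?a mod M * (?a mod M) + ?b mod M * (?b mod M)) mod M = (?a * ?a + ?b * ?b) mod M"
      "(?b mod M * (2 * (?a mod M) + ?b mod M)) mod M = (?b * (2 * ?a + ?b)) mod M"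
      unfolding cong_def [symmetric]
      by (intro cong_mult cong_add cong_diff cong_refl; simp add: cong_def)+
    show ?thesis
    proof (cases "even n")
      case True
      then have "n = h + h" "int n mod 2 = 0" by (auto simp: h_def)
      then show ?thesis using False h A B m
        by (subst fib_dbl.simps) (simp add: fibpair_def)
    next
      case odd: False
      then have "n = Suc (h + h)" "int n mod 2 = 1"
        by (auto simp: h_def elim!: oddE)
      then show ?thesis using False h C B m
        by (subst fib_dbl.simps) (simp add: fibpair_def)
    qed
  qed
qed

lemma fibpair_periodic:
  assumes "1 < M" "fibpair M p = (0, 1)"
  shows "fibpair M (n + p * t) = fibpair M n"
proof -
  have step: "fibpair M (n + p) = fibpair M n" for n
  proof -
    have p: "[fibi p = 0] (mod M)" "[fibi (Suc p) = 1] (mod M)"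
      using assms by (simp_all add: fibpair_def cong_def)
    have "[fibi (Suc (n + p)) = fibi (Suc n) * 1 + fibi n * 0] (mod M)"
      unfolding fibi_add by (intro cong_add cong_mult p cong_refl)
    moreover have "[fibi (n + p) = fibi n * 1 + (fibi (Suc n) - fibi n) * 0] (mod M)"
      unfolding fibi_add' by (intro cong_add cong_mult p cong_refl)
    ultimately show ?thesis by (simp add: fibpair_def cong_def)
  qed
  show ?thesis
  proof (induction t)
    case (Suc t)
    then show ?case using step[of "n + p * t"] by (simp add: algebra_simps)
  qed simp
qed

fun fib_tab :: "int \<Rightarrow> int \<Rightarrow> int \<Rightarrow> nat \<Rightarrow> (int \<times> int) list" where
  "fib_tab M a b 0 = []"
| "fib_tab M a b (Suc n) = (a, b) # fib_tab M b ((a + b) mod M) n"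

lemma fib_tab_nth:
  assumes "i < n"
  shows "fib_tab M (fibi j mod M) (fibi (Suc j) mod M) n ! i = fibpair M (j + i)"
  using assms
proof (induction n arbitrary: i j)
  case (Suc n)
  have "(fibi j mod M + fibi (Suc j) mod M) mod M = fibi (Suc (Suc j)) mod M"
    by (simp add: mod_simps add.commute)
  then have "fib_tab M (fibi j mod M) (fibi (Suc j) mod M) (Suc n)
      = fibpair M j # fib_tab M (fibi (Suc j) mod M) (fibi (Suc (Suc j)) mod M) n"
    by (simp add: fibpair_def del: fib.simps)
  then show ?case using Suc by (cases i) (auto simp del: fib.simps fib_tab.simps)
qed simp

function pow_dbl :: "int \<Rightarrow> int \<Rightarrow> int \<Rightarrow> int" where
  "pow_dbl M g i = (if i \<le> 0 then 1 else
     (if i mod 2 = 0 then (pow_dbl M g (i div 2))\<^sup>2 mod M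
      else (g * (pow_dbl M g (i div 2))\<^sup>2) mod M))"
  by auto
termination by (relation "measure (\<lambda>(M, g, i). nat i)") auto

declare pow_dbl.simps [simp del]

lemma pow_dbl_cong: "[pow_dbl M g (int n) = g ^ n] (mod M)"
proof (induction n rule: less_induct)
  case (less n)
  show ?case
  proof (cases "n = 0")
    case False
    define h where "h = n div 2"
    have "[pow_dbl M g (int h) = g ^ h] (mod M)"
      using less[of h] False by (simp add: h_def)
    then have h: "[(pow_dbl M g (int n div 2))\<^sup>2 = (g ^ h)\<^sup>2] (mod M)"
      by (simp add: h_def zdiv_int cong_pow)
    show ?thesis
    proof (cases "even n")
      case True
      then have n: "n = 2 * h" "int n mod 2 = 0" by (auto simp: h_def)
      then have "g ^ n = (g ^ h)\<^sup>2" by (simp add: power_mult[symmetric] mult.commute)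
      then show ?thesis using False n(2) h
        by (subst pow_dbl.simps) (simp add: cong_def)
    next
      case odd: False
      then have n: "n = Suc (2 * h)" "int n mod 2 = 1" by (auto simp: h_def elim!: oddE)
      then have "g ^ n = g * (g ^ h)\<^sup>2" by (simp add: power_mult[symmetric] mult.commute)
      moreover have "[g * (pow_dbl M g (int n div 2))\<^sup>2 = g * (g ^ h)\<^sup>2] (mod M)"
        using h by (rule cong_scalar_left)
      ultimately show ?thesis using False n(2)
        by (subst pow_dbl.simps) (simp add: cong_def)
    qed
  qed (simp add: pow_dbl.simps)
qed

fun pow_tab :: "int \<Rightarrow> int \<Rightarrow> int \<Rightarrow> nat \<Rightarrow> int list" where
  "pow_tab M g x 0 = []"
| "pow_tab M g x (Suc n) = x # pow_tab M g ((x * g) mod M) n"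

lemma pow_tab_nth:
  assumes "i < n"
  shows "[pow_tab M g x n ! i = x * g ^ i] (mod M)"
  using assms
proof (induction n arbitrary: i x)
  case (Suc n)
  show ?case
  proof (cases i)
    case (Suc i')
    then have "[pow_tab M g ((x * g) mod M) n ! i' = (x * g) mod M * g ^ i'] (mod M)"
      using Suc.prems by (intro Suc.IH) simp
    also have "[(x * g) mod M * g ^ i' = x * g * g ^ i'] (mod M)"
      by (intro cong_mult cong_refl) (simp add: cong_def)
    finally show ?thesis using Suc by (simp add: mult.assoc)
  qed simp
qed simp

text \<open>The empty list marks a period above 100 that is not tabulated; the power is then
  computed by doubling. \<open>lookup\<close> follows the same convention.\<close>

definition pow_lookup :: "int \<Rightarrow> int \<Rightarrow> int \<Rightarrow> int list \<Rightarrow> int \<Rightarrow> int" where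
  "pow_lookup M g l G i = (if G = [] then pow_dbl M g (i mod l) else G ! nat (i mod l))"

definition pow_table :: "int \<Rightarrow> int \<Rightarrow> int \<Rightarrow> int list" where
  "pow_table M g l = (if l \<le> 100 then pow_tab M g 1 (nat l) else [])"

lemma pow_lookup_cong:
  assumes "0 < l"
  shows "[pow_lookup M g l (pow_table M g l) i = g ^ nat (i mod l)] (mod M)"
proof (cases "l \<le> 100")
  case True
  have "nat (i mod l) < nat l" using assms by (simp add: nat_less_eq_zless)
  then have "[pow_tab M g 1 (nat l) ! nat (i mod l) = 1 * g ^ nat (i mod l)] (mod M)"
    by (rule pow_tab_nth)
  moreover have "pow_tab M g 1 (nat l) \<noteq> []" using assms by (cases "nat l") auto
  ultimately show ?thesis using True by (simp add: pow_lookup_def pow_table_def)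
next
  case False
  then show ?thesis
    using pow_dbl_cong[of M g "nat (i mod l)"] assms by (simp add: pow_lookup_def pow_table_def)
qed

definition lookup :: "int \<Rightarrow> int \<Rightarrow> (int \<times> int) list \<Rightarrow> int \<Rightarrow> int \<times> int" where
  "lookup M p T i = (if T = [] then fib_dbl M (i mod p) else T ! nat (i mod p))"

definition table :: "int \<Rightarrow> int \<Rightarrow> (int \<times> int) list" where
  "table M p = (if p \<le> 100 then fib_tab M 0 1 (nat p) else [])"

lemma fibpair_mod:
  assumes "1 < M" "0 < p" "fib_dbl M p = (0, 1)" "int n mod p = i mod p"
  shows "fibpair M (nat (i mod p)) = fibpair M n"
proof -
  have "fibpair M (nat p) = (0, 1)"
    using assms fib_dbl_eq[of M "nat p"] by simp
  moreover have "nat (i mod p) = n mod nat p"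
    using assms by (metis nat_int nat_mod_distrib of_nat_0_le_iff order.strict_implies_order)
  ultimately show ?thesis
    using fibpair_periodic[of M "nat p" "n mod nat p" "n div nat p"] assms(1)
    by simp
qed

lemma lookup_table:
  assumes "1 < M" "0 < p" "fib_dbl M p = (0, 1)" "int n mod p = i mod p"
  shows "lookup M p (table M p) i = fibpair M n"
proof (cases "p \<le> 100")
  case True
  have "nat (i mod p) < nat p" using assms by (simp add: nat_less_eq_zless)
  then have "fib_tab M (fibi 0 mod M) (fibi (Suc 0) mod M) (nat p) ! nat (i mod p)
      = fibpair M (0 + nat (i mod p))"
    by (rule fib_tab_nth)
  then have "fib_tab M 0 1 (nat p) ! nat (i mod p) = fibpair M (nat (i mod p))"
    using assms(1) by simp
  moreover have "fib_tab M 0 1 (nat p) \<noteq> []"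
    using assms(2) by (cases "nat p") auto
  ultimately show ?thesis
    using True fibpair_mod[OF assms] by (simp add: lookup_def table_def)
next
  case False
  have "fib_dbl M (i mod p) = fibpair M (nat (i mod p))"
    using fib_dbl_eq[of M "nat (i mod p)"] assms by simp
  then show ?thesis
    using False fibpair_mod[OF assms] by (simp add: lookup_def table_def)
qed

section \<open>Residue classes and the soundness of the sieve\<close>

text \<open>
  A sieve state is a list of residue classes \<open>(a, b, c)\<close> of a triple \<open>(x, y, z)\<close> modulo \<open>(A, B, C)\<close>.
  \<open>Lift\<close> multiplies the three moduli and \<open>Coarse\<close> replaces them by divisors; \<open>Par\<close> discards the
  classes with \<open>y\<close> and \<open>z\<close> even. \<open>Pow M p l\<close> tests the equation modulo \<open>M\<close>, where \<open>p\<close> is a period of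
  the Fibonacci sequence and \<open>l\<close> a period of the powers of \<open>g\<close>; \<open>Van M p\<close> does the same when \<open>M\<close>
  divides \<open>g\<^sup>E\<close>, so that \<open>g\<^sup>z\<close> vanishes for \<open>z \<ge> E\<close>.
\<close>

datatype step = Lift int int int | Coarse int int int | Par | Pow int int int | Van int int

datatype class_tree = Empty | Class int int int | Join class_tree class_tree

fun class_set :: "class_tree \<Rightarrow> (int \<times> int \<times> int) set" where
  "class_set Empty = {}"
| "class_set (Class a b c) = {(a, b, c)}"
| "class_set (Join s t) = class_set s \<union> class_set t"

text \<open>Empty operands are dropped, so that a filtered state without classes is literally
  \<open>Empty\<close>, which is what \<open>sieve\<close> compares with.\<close>

fun merge :: "class_tree \<Rightarrow> class_tree \<Rightarrow> class_tree" where
  "merge Empty t = t"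
| "merge s Empty = s"
| "merge s t = Join s t"

lemma class_set_merge: "class_set (merge s t) = class_set s \<union> class_set t"
  by (induction s t rule: merge.induct) auto

fun to_list :: "class_tree \<Rightarrow> (int \<times> int \<times> int) list" where
  "to_list Empty = []"
| "to_list (Class a b c) = [(a, b, c)]"
| "to_list (Join s t) = to_list s @ to_list t"

fun of_list :: "(int \<times> int \<times> int) list \<Rightarrow> class_tree" where
  "of_list [] = Empty"
| "of_list ((a, b, c) # ts) = merge (Class a b c) (of_list ts)"

lemma set_to_list: "set (to_list s) = class_set s"
  by (induction s) auto

lemma class_set_of_list: "class_set (of_list ts) = set ts"
  by (induction ts rule: of_list.induct) (auto simp: class_set_merge)

fun lift :: "int \<Rightarrow> int \<Rightarrow> int \<Rightarrow> int \<Rightarrow> int \<Rightarrow> int \<Rightarrow> class_tree \<Rightarrow> class_tree" where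
  "lift A B C a b c Empty = Empty"
| "lift A B C a b c (Class x y z) = of_list (concat (map (\<lambda>i. concat (map (\<lambda>j.
     map (\<lambda>k. (x + A * i, y + B * j, z + C * k)) (upto 0 (c - 1))) (upto 0 (b - 1)))) (upto 0 (a - 1))))"
| "lift A B C a b c (Join s t) = Join (lift A B C a b c s) (lift A B C a b c t)"

lemma in_lift:
  assumes "(x, y, z) \<in> class_set S" "i \<in> {0..a - 1}" "j \<in> {0..b - 1}" "k \<in> {0..c - 1}"
  shows "(x + A * i, y + B * j, z + C * k) \<in> class_set (lift A B C a b c S)"
  using assms(1)
proof (induction S)
  case (Class x' y' z')
  have "(x + A * i, y + B * j, z + C * k) \<in> (\<lambda>k. (x + A * i, y + B * j, z + C * k)) ` {0..c - 1}"
    using assms(4) by (rule imageI)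
  then have "\<exists>i\<in>{0..a - 1}. \<exists>j\<in>{0..b - 1}. (x + A * i', y + B * j', z + C * k)
      \<in> (\<lambda>k. (x + A * i, y + B * j, z + C * k)) ` {0..c - 1}" if "i' = i" "j' = j" for i' j'
    using assms(2,3) that by blast
  then show ?case using Class by (simp add: class_set_of_list)
qed auto

text \<open>The arguments are, in order: the modulus M, a Fibonacci period p, the modulus Q of the
  second coordinate, the Fibonacci table, the residues of x and y, and a representative of g^z
  modulo M.\<close>

type_synonym class_test = "int \<Rightarrow> int \<Rightarrow> int \<Rightarrow> (int \<times> int) list \<Rightarrow> int \<Rightarrow> int \<Rightarrow> int \<Rightarrow> bool"

fun survivors :: "class_test \<Rightarrow> int \<Rightarrow> int \<Rightarrow> int \<Rightarrow> int \<Rightarrow> (int \<times> int) list \<Rightarrow> int list \<Rightarrow> int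
    \<Rightarrow> class_tree \<Rightarrow> class_tree" where
  "survivors K g M p Q T G l Empty = Empty"
| "survivors K g M p Q T G l (Class a b c) =
     (if K M p Q T a b (pow_lookup M g l G c) then Class a b c else Empty)"
| "survivors K g M p Q T G l (Join s t) = merge (survivors K g M p Q T G l s) (survivors K g M p Q T G l t)"

lemma set_survivors: "class_set (survivors K g M p Q T G l S) =
    {(a, b, c) \<in> class_set S. K M p Q T a b (pow_lookup M g l G c)}"
  by (induction S) (auto simp: class_set_merge)

fun odd_part :: "class_tree \<Rightarrow> class_tree" where
  "odd_part Empty = Empty"
| "odd_part (Class a b c) = (if b mod 2 = 1 \<or> c mod 2 = 1 then Class a b c else Empty)"
| "odd_part (Join s t) = merge (odd_part s) (odd_part t)"

lemma class_set_odd_part: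
  "class_set (odd_part S) = {(a, b, c) \<in> class_set S. b mod 2 = 1 \<or> c mod 2 = 1}"
  by (induction S) (auto simp: class_set_merge)

fun sieve :: "class_test \<Rightarrow> int \<Rightarrow> nat \<Rightarrow> step list \<Rightarrow> int \<Rightarrow> int \<Rightarrow> int \<Rightarrow> class_tree \<Rightarrow> bool" where
  "sieve K g E [] A B C S = (S = Empty)"
| "sieve K g E (s # ss) A B C S = (if S = Empty then True else case s of
     Lift a b c \<Rightarrow> (if 0 < a \<and> 0 < b \<and> 0 < c
       then sieve K g E ss (A * a) (B * b) (C * c) (lift A B C a b c S) else False)
   | Coarse a b c \<Rightarrow> (if 0 < a \<and> 0 < b \<and> 0 < c \<and> A mod a = 0 \<and> B mod b = 0 \<and> C mod c = 0
       then sieve K g E ss a b c (of_list (remdups (map (\<lambda>(x, y, z). (x mod a, y mod b, z mod c)) (to_list S)))) else False)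
   | Par \<Rightarrow> (if B mod 2 = 0 \<and> C mod 2 = 0
       then sieve K g E ss A B C (odd_part S) else False)
   | Pow M p l \<Rightarrow> (if 1 < M \<and> 0 < p \<and> 0 < l \<and> A mod p = 0 \<and> C mod l = 0 \<and> fib_dbl M p = (0, 1)
         \<and> pow_dbl M g l = 1
       then sieve K g E ss A B C (survivors K g M p B (table M p) (pow_table M g l) l S) else False)
   | Van M p \<Rightarrow> (if 1 < M \<and> 0 < p \<and> A mod p = 0 \<and> fib_dbl M p = (0, 1) \<and> g ^ E mod M = 0
       then sieve K g E ss A B C (survivors K g M p B (table M p) [0] 1 S) else False))"

lemma mod_mono_dvd:
  fixes x a :: int
  assumes "x mod A = a mod A" "A mod p = 0"
  shows "x mod p = a mod p"
  using assms by (metis mod_mod_cancel dvd_eq_mod_eq_0)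

lemma mod_lift:
  fixes x a A p :: int
  assumes "x mod A = a mod A" "0 < A" "0 < p"
  obtains i where "i \<in> {0..p - 1}" "x mod (A * p) = (a + A * i) mod (A * p)"
proof -
  obtain t where t: "x = a + A * t"
    using assms(1) by (metis mod_eqE)
  have 1: "t mod p \<in> {0..p - 1}" using assms(3) by simp
  have "x = a + A * (t mod p) + A * p * (t div p)"
    using t by (metis add.assoc distrib_left mult.assoc mod_mult_div_eq)
  then have "x mod (A * p) = (a + A * (t mod p)) mod (A * p)"
    by simp
  with 1 show thesis by (rule that)
qed

text \<open>The assumption \<open>keep\<close> says that the test never rejects the class of the
  given triple. Every step then passes that class on (\<open>par\<close> is what \<open>Par\<close>
  relies on, \<open>E\<close> what \<open>Van\<close> relies on), so the state cannot end
  empty.\<close>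

theorem sieve_sound:
  fixes x y z :: nat and g :: int
  assumes keep: "\<And>M p Q T a b w. 1 < M \<Longrightarrow> 0 < p \<Longrightarrow>
      (\<And>n i. int n mod p = i mod p \<Longrightarrow> lookup M p T i = fibpair M n) \<Longrightarrow>
      [w = g ^ z] (mod M) \<Longrightarrow> int x mod p = a mod p \<Longrightarrow> int y mod Q = b mod Q \<Longrightarrow> K M p Q T a b w"
    and par: "odd y \<or> odd z" and E: "E \<le> z"
  shows "sieve K g E ss A B C S \<Longrightarrow> 0 < A \<Longrightarrow> 0 < B \<Longrightarrow> 0 < C \<Longrightarrow>
    (a, b, c) \<in> class_set S \<Longrightarrow> int x mod A = a mod A \<Longrightarrow> int y mod B = b mod B \<Longrightarrow>
    int z mod C = c mod C \<Longrightarrow> False"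
proof (induction ss arbitrary: A B C S a b c)
  case (Cons s ss)
  have ne: "S \<noteq> Empty" using Cons.prems by auto
  show ?case
  proof (cases s)
    case (Lift a' b' c')
    then have pos: "0 < a'" "0 < b'" "0 < c'"
      and r: "sieve K g E ss (A * a') (B * b') (C * c') (lift A B C a' b' c' S)"
      using Cons.prems(1) ne by (auto split: if_splits)
    obtain i where i: "i \<in> {0..a' - 1}" "int x mod (A * a') = (a + A * i) mod (A * a')"
      using mod_lift Cons.prems pos by metis
    obtain j where j: "j \<in> {0..b' - 1}" "int y mod (B * b') = (b + B * j) mod (B * b')"
      using mod_lift Cons.prems pos by metis
    obtain k where k: "k \<in> {0..c' - 1}" "int z mod (C * c') = (c + C * k) mod (C * c')"
      using mod_lift Cons.prems pos by metis
    have "(a + A * i, b + B * j, c + C * k) \<in> class_set (lift A B C a' b' c' S)"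
      by (rule in_lift[OF Cons.prems(5) i(1) j(1) k(1)])
    from Cons.IH[OF r _ _ _ this i(2) j(2) k(2)] show False
      using Cons.prems pos by simp
  next
    case (Coarse a' b' c')
    then have pos: "0 < a'" "0 < b'" "0 < c'" "A mod a' = 0" "B mod b' = 0" "C mod c' = 0"
      and r: "sieve K g E ss a' b' c' (of_list (remdups (map (\<lambda>(x, y, z). (x mod a', y mod b', z mod c')) (to_list S))))"
      using Cons.prems(1) ne by (auto split: if_splits)
    have "(a mod a', b mod b', c mod c') \<in>
        class_set (of_list (remdups (map (\<lambda>(x, y, z). (x mod a', y mod b', z mod c')) (to_list S))))"
      using Cons.prems(5) by (force simp: class_set_of_list set_to_list)
    from Cons.IH[OF r pos(1-3) this] show False
      using mod_mono_dvd[OF Cons.prems(6) pos(4)] mod_mono_dvd[OF Cons.prems(7) pos(5)]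
        mod_mono_dvd[OF Cons.prems(8) pos(6)] by simp
  next
    case Par
    then have B: "B mod 2 = 0" "C mod 2 = 0"
      and r: "sieve K g E ss A B C (odd_part S)"
      using Cons.prems(1) ne by (auto split: if_splits)
    have "b mod 2 = int y mod 2" "c mod 2 = int z mod 2"
      using mod_mono_dvd Cons.prems B by metis+
    moreover have "int y mod 2 = 1 \<or> int z mod 2 = 1"
      using par by presburger
    ultimately have "(a, b, c) \<in> class_set (odd_part S)"
      using Cons.prems(5) by (auto simp: class_set_odd_part)
    from Cons.IH[OF r _ _ _ this] show False using Cons.prems by blast
  next
    case (Pow M p l)
    then have M: "1 < M" "0 < p" "0 < l" "A mod p = 0" "C mod l = 0" "fib_dbl M p = (0, 1)"
        "pow_dbl M g l = 1"
      and r: "sieve K g E ss A B C (survivors K g M p B (table M p) (pow_table M g l) l S)"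
      using Cons.prems(1) ne by (auto split: if_splits)
    have gl: "[g ^ nat l = 1] (mod M)"
      using pow_dbl_cong[of M g "nat l"] M by (simp add: cong_sym)
    have zl: "nat (c mod l) = z mod nat l"
    proof -
      have "int z mod l = c mod l" using mod_mono_dvd Cons.prems M by metis
      then show ?thesis using M(3)
        by (metis nat_int nat_mod_distrib of_nat_0_le_iff order.strict_implies_order)
    qed
    have "[pow_lookup M g l (pow_table M g l) c = g ^ nat (c mod l)] (mod M)"
      using M(3) by (rule pow_lookup_cong)
    moreover have "[g ^ z = g ^ nat (c mod l)] (mod M)"
    proof -
      have "g ^ z = (g ^ nat l) ^ (z div nat l) * g ^ (z mod nat l)"
        by (metis power_add power_mult mult_div_mod_eq)
      moreover have "[(g ^ nat l) ^ (z div nat l) * g ^ (z mod nat l) = 1 ^ (z div nat l) * g ^ (z mod nat l)] (mod M)"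
        using gl by (intro cong_mult cong_pow cong_refl)
      ultimately show ?thesis using zl by simp
    qed
    ultimately have w: "[pow_lookup M g l (pow_table M g l) c = g ^ z] (mod M)"
      by (metis cong_sym cong_trans)
    have "K M p B (table M p) a b (pow_lookup M g l (pow_table M g l) c)"
      using Cons.prems M w by (intro keep lookup_table) (auto intro: mod_mono_dvd)
    then have "(a, b, c) \<in> class_set (survivors K g M p B (table M p) (pow_table M g l) l S)"
      using Cons.prems(5) by (simp add: set_survivors)
    from Cons.IH[OF r _ _ _ this] show False using Cons.prems by blast
  next
    case (Van M p)
    then have M: "1 < M" "0 < p" "A mod p = 0" "fib_dbl M p = (0, 1)" "g ^ E mod M = 0"
      and r: "sieve K g E ss A B C (survivors K g M p B (table M p) [0] 1 S)"
      using Cons.prems(1) ne by (auto split: if_splits)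
    have "M dvd g ^ z"
      using M(5) E by (meson dvd_trans le_imp_power_dvd mod_0_imp_dvd)
    \<comment> \<open>The one-entry table with period 1 returns 0 for every class, the value of g^z
      modulo M.\<close>
    then have w: "[pow_lookup M g 1 [0] c = g ^ z] (mod M)"
      by (simp add: cong_def pow_lookup_def)
    have "K M p B (table M p) a b (pow_lookup M g 1 [0] c)"
      using Cons.prems M w by (intro keep lookup_table) (auto intro: mod_mono_dvd)
    then have "(a, b, c) \<in> class_set (survivors K g M p B (table M p) [0] 1 S)"
      using Cons.prems(5) by (simp add: set_survivors)
    from Cons.IH[OF r _ _ _ this] show False using Cons.prems by blast
  qed
qed simp

declare sieve.simps [simp del]

section \<open>The two residue tests and what an emptied sieve proves\<close>

text \<open>Once m and j = n - k are fixed, the equation is linear in F_k, F_{k+1} and g^z; the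
  first coordinate x is k.\<close>

definition linear_test :: "int \<Rightarrow> int \<Rightarrow> int \<Rightarrow> class_test" where
  "linear_test \<alpha> \<beta> \<gamma> M p Q T a b w =
     (case lookup M p T a of (u, v) \<Rightarrow> (\<alpha> * u + \<beta> * v - \<gamma> * w) mod M = 0)"

text \<open>Here x = m, y = q and k = 2xy. With (u, v) = (F_m, F_{m+1}) and (s, t) = (F_k, F_{k+1}),
  the tested expression is L_{m+k} - L_m g^z - F_k, since L_m = 2v - u and L_{m-1} = 3u - v. As y is
  known only modulo Q, the residue of k modulo p is determined only when p divides 2aQ; otherwise
  the class is kept.\<close>

definition multiple_test :: class_test where
  "multiple_test M p Q T a b w =
     (if (2 * a * Q) mod p = 0 then
        (case lookup M p T a of (u, v) \<Rightarrow> case lookup M p T (2 * a * b) of (s, t) \<Rightarrow>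
          ((2 * v - u) * (t - w) + (3 * u - v - 1) * s) mod M = 0)
      else True)"

fun fib_seq :: "int \<Rightarrow> int \<Rightarrow> nat \<Rightarrow> int list" where
  "fib_seq a b 0 = []"
| "fib_seq a b (Suc n) = a # fib_seq b (a + b) n"

lemma length_fib_seq: "length (fib_seq a b n) = n"
  by (induction a b n rule: fib_seq.induct) auto

lemma fib_seq_lucas: "i < n \<Longrightarrow> fib_seq (luci j) (luci (Suc j)) n ! i = luci (j + i)"
proof (induction n arbitrary: i j)
  case (Suc n)
  then show ?case
    using Suc.IH[of _ "Suc j"] by (cases i) (auto simp: add.commute)
qed simp

lemma fib_seq_fib: "i < n \<Longrightarrow> fib_seq (fibi j) (fibi (Suc j)) n ! i = fibi (j + i)"
proof (induction n arbitrary: i j)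
  case (Suc n)
  then show ?case
    using Suc.IH[of _ "Suc j"] by (cases i) (auto simp: add.commute)
qed simp

lemma luci_in_fib_seq: "i < n \<Longrightarrow> (i, luci i) \<in> set (zip [0..<n] (fib_seq 2 1 n))"
  using fib_seq_lucas[of i n 0] by (auto simp: set_zip length_fib_seq intro!: exI[of _ i])

lemma fibi_in_fib_seq: "i < n \<Longrightarrow> (i, fibi i) \<in> set (zip [0..<n] (fib_seq 0 1 n))"
  using fib_seq_fib[of i n 0] by (auto simp: set_zip length_fib_seq intro!: exI[of _ i])

text \<open>
  Here \<open>(u, v, c) = (L\<^sub>j, L\<^bsub>j+1\<^esub>, L\<^sub>m)\<close>; the first two branches drop the pairs \<open>(m, j)\<close> that the bounds
  \<open>8/5 \<le> F\<^bsub>k+1\<^esub> / F\<^sub>k \<le> 5/3\<close> exclude on size grounds.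
\<close>

definition small_sieve :: "int \<Rightarrow> nat \<Rightarrow> int \<Rightarrow> step list \<Rightarrow> bool" where
  "small_sieve g E B ss = list_all (\<lambda>c. list_all (\<lambda>(u, v).
     if 5 * (B * c + 1) < 3 * u + 5 * v then True
     else if 2 * u + 3 * v \<le> 3 * (c + 1) then True
     else sieve (linear_test (v - u - 1) u c) g E ss 1 1 1 (Class 0 0 0)) (zip (fib_seq 2 1 14) (fib_seq 1 3 14)))
     (fib_seq 2 1 10)"

lemma multiple_test_sound:
  fixes x y z :: nat and g :: int
  assumes eq: "luci (x + 2 * x * y) = luci x * g ^ z + fibi (2 * x * y)"
    and tab: "\<And>n i. int n mod p = i mod p \<Longrightarrow> lookup M p T i = fibpair M n"
    and w: "[w = g ^ z] (mod M)" and a: "int x mod p = a mod p" and b: "int y mod Q = b mod Q"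
  shows "multiple_test M p Q T a b w"
proof (cases "(2 * a * Q) mod p = 0")
  case True
  define k where "k = 2 * x * y"
  have "int k mod p = (2 * a * b) mod p"
  proof -
    have "[int x = a] (mod p)" using a by (simp add: cong_def)
    then have "[int k = 2 * a * int y] (mod p)"
      unfolding k_def of_nat_mult by (intro cong_mult) auto
    moreover obtain t where "int y = b + Q * t" using b by (metis mod_eqE)
    then have "2 * a * int y = 2 * a * b + 2 * a * Q * t" by (simp add: algebra_simps)
    moreover have "[2 * a * b + 2 * a * Q * t = 2 * a * b + 0 * t] (mod p)"
      using True by (intro cong_add cong_mult cong_refl) (simp add: cong_def)
    ultimately show ?thesis by (simp add: cong_def)
  qed
  then have 2: "lookup M p T (2 * a * b) = fibpair M k" and 1: "lookup M p T a = fibpair M x"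
    using tab a by auto
  have lx: "luci x = 2 * fibi (Suc x) - fibi x"
    "luci (Suc x) - luci x = 3 * fibi x - fibi (Suc x)"
    by (simp_all add: luci_fibi)
  have "(2 * fibi (Suc x) - fibi x) * (fibi (Suc k) - g ^ z)
      + (3 * fibi x - fibi (Suc x) - 1) * fibi k = 0"
    using eq unfolding k_def[symmetric] luci_add lx(2) unfolding lx(1) by (simp add: algebra_simps)
  moreover have "[(2 * (fibi (Suc x) mod M) - fibi x mod M) * (fibi (Suc k) mod M - w)
      + (3 * (fibi x mod M) - fibi (Suc x) mod M - 1) * (fibi k mod M)
      = (2 * fibi (Suc x) - fibi x) * (fibi (Suc k) - g ^ z)
      + (3 * fibi x - fibi (Suc x) - 1) * fibi k] (mod M)"
    by (intro cong_mult cong_add cong_diff cong_refl w) (simp_all add: cong_def)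
  ultimately show ?thesis
    using True 1 2 by (simp add: multiple_test_def fibpair_def cong_def)
qed (simp add: multiple_test_def)

lemma linear_test_sound:
  fixes x z :: nat and g :: int
  assumes eq: "\<alpha> * fibi x + \<beta> * fibi (Suc x) = \<gamma> * g ^ z"
    and tab: "\<And>n i. int n mod p = i mod p \<Longrightarrow> lookup M p T i = fibpair M n"
    and w: "[w = g ^ z] (mod M)" and a: "int x mod p = a mod p"
  shows "linear_test \<alpha> \<beta> \<gamma> M p Q T a b w"
proof -
  have "[\<alpha> * (fibi x mod M) + \<beta> * (fibi (Suc x) mod M) - \<gamma> * w
      = \<alpha> * fibi x + \<beta> * fibi (Suc x) - \<gamma> * g ^ z] (mod M)"
    by (intro cong_mult cong_add cong_diff cong_refl w) (simp_all add: cong_def)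
  then show ?thesis
    using tab[OF a] eq by (simp add: linear_test_def fibpair_def cong_def)
qed

text \<open>With all three moduli equal to 1, the class (0, 0, 0) contains every triple.\<close>

lemma multiple_sieve_sound:
  fixes m q D :: nat and g :: int
  assumes "sieve multiple_test g E ss 1 1 1 (Class 0 0 0)" "E \<le> D" "odd q \<or> odd D"
  shows "luci (m + 2 * m * q) \<noteq> luci m * g ^ D + fibi (2 * m * q)"
proof
  assume eq: "luci (m + 2 * m * q) = luci m * g ^ D + fibi (2 * m * q)"
  show False
    by (rule sieve_sound[where K = multiple_test and x = m and y = q and z = D and a = 0 and b = 0 and c = 0,
          OF multiple_test_sound[OF eq] assms(3,2,1)]) auto
qed

lemma small_sieve_sound:
  fixes k m j D :: nat and g B :: int
  assumes sieve: "small_sieve g E B ss" and "E \<le> D" "m < 10" "j < 14" "4 \<le> k"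
    and eq: "luci (k + j) = luci m * g ^ D + fibi k"
    and D: "fibi k < g ^ D" "g ^ D \<le> B * fibi k"
  shows False
proof -
  define u v c where "u = luci j" "v = luci (Suc j)" "c = luci m"
  have c: "c \<in> set (fib_seq 2 1 10)"
    using luci_in_fib_seq[OF \<open>m < 10\<close>] by (auto simp: u_v_c_def dest: set_zip_rightD)
  have uv: "(u, v) \<in> set (zip (fib_seq 2 1 14) (fib_seq 1 3 14))"
    using fib_seq_lucas[OF \<open>j < 14\<close>, of 0] fib_seq_lucas[OF \<open>j < 14\<close>, of 1] \<open>j < 14\<close>
    by (force simp: set_zip length_fib_seq u_v_c_def numeral_2_eq_2)
  have "1 \<le> c" "0 < u" "0 < v" using lucas_pos[of m] lucas_pos[of j] lucas_pos[of "Suc j"]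
    unfolding u_v_c_def by simp_all
  have e: "v * fibi k + u * (fibi (Suc k) - fibi k) = c * g ^ D + fibi k"
    using eq unfolding add.commute[of k] luci_add u_v_c_def by (simp add: algebra_simps)
  \<comment> \<open>With s = F_{k-4} and t = F_{k-3}, the bounds 8/5 <= F_{k+1} / F_k <= 5/3 reduce
    to s <= t and 0 <= s.\<close>
  obtain i where "k = 4 + i" using \<open>4 \<le> k\<close> le_Suc_ex by blast
  then have i: "k = Suc (Suc (Suc (Suc i)))" by simp
  define s t where "s = fibi i" "t = fibi (Suc i)"
  have st: "0 \<le> s" "0 < t" "s \<le> t"
    unfolding s_t_def using fib_mono[of i "Suc i"] by (auto simp: fib_neq_0_nat)
  have fk: "fibi k = 2 * s + 3 * t" "fibi (Suc k) = 3 * s + 5 * t"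
    unfolding i s_t_def by simp_all
  have pos: "0 < fibi k" using fk st by simp
  let ?x = "g ^ D"
  have lo: "c * fibi k < c * ?x" and hi: "c * ?x \<le> c * (B * fibi k)"
    using D \<open>1 \<le> c\<close> by (simp_all add: mult_left_mono)
  have e': "v * fibi k + u * fibi (Suc k) = u * fibi k + c * ?x + fibi k"
    using e by (simp add: right_diff_distrib)
  have "\<not> 5 * (B * c + 1) < 3 * u + 5 * v"
  proof
    assume "5 * (B * c + 1) < 3 * u + 5 * v"
    then have "5 * (B * c + 1) * fibi k < (3 * u + 5 * v) * fibi k"
      using pos by (rule mult_strict_right_mono)
    then have "5 * (c * (B * fibi k)) + 5 * fibi k < 3 * (u * fibi k) + 5 * (v * fibi k)"
      by (simp add: algebra_simps)
    moreover have "u * (8 * fibi k) \<le> u * (5 * fibi (Suc k))"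
      using fk st \<open>0 < u\<close> by (intro mult_left_mono) auto
    ultimately show False using e' hi by linarith
  qed
  moreover have "\<not> 2 * u + 3 * v \<le> 3 * (c + 1)"
  proof
    assume "2 * u + 3 * v \<le> 3 * (c + 1)"
    then have "(2 * u + 3 * v) * fibi k \<le> 3 * (c + 1) * fibi k"
      using pos by (intro mult_right_mono) auto
    then have "2 * (u * fibi k) + 3 * (v * fibi k) \<le> 3 * (c * fibi k) + 3 * fibi k"
      by (simp add: algebra_simps)
    moreover have "u * (3 * fibi (Suc k)) \<le> u * (5 * fibi k)"
      using fk st \<open>0 < u\<close> by (intro mult_left_mono) auto
    ultimately show False using e' lo by linarith
  qed
  ultimately have sk: "\<not> 5 * (B * c + 1) < 3 * u + 5 * v" "\<not> 2 * u + 3 * v \<le> 3 * (c + 1)"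
    by blast+
  have r: "sieve (linear_test (v - u - 1) u c) g E ss 1 1 1 (Class 0 0 0)"
  proof -
    have "\<forall>c\<in>set (fib_seq 2 1 10). \<forall>(u, v)\<in>set (zip (fib_seq 2 1 14) (fib_seq 1 3 14)).
        if 5 * (B * c + 1) < 3 * u + 5 * v then True
        else if 2 * u + 3 * v \<le> 3 * (c + 1) then True
        else sieve (linear_test (v - u - 1) u c) g E ss 1 1 1 (Class 0 0 0)"
      using sieve unfolding small_sieve_def list_all_iff .
    from bspec[OF bspec[OF this c] uv] show ?thesis using sk by simp
  qed
  have "(v - u - 1) * fibi k + u * fibi (Suc k) = c * g ^ D"
    using e by (simp add: algebra_simps)
  note k = linear_test_sound[OF this]
  \<comment> \<open>The equation concerns only k and D; the choice y = 1 meets the parity hypothesis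
    of \<open>sieve_sound\<close>.\<close>
  show False
    by (rule sieve_sound[where K = "linear_test (v - u - 1) u c" and x = k and y = 1 and z = D and a = 0
          and b = 0 and c = 0, OF k _ \<open>E \<le> D\<close> r]) auto
qed

subsection \<open>Reduction modulo a Lucas number\<close>

lemma fib_less_lucas:
  assumes "10 \<le> m"
  shows "fibi m + 4 < luci m" "34 \<le> fibi (m - 1)" "2 < luci (m - 2)"
proof -
  have "fib 9 \<le> fib (m - 1)" using assms by (intro fib_mono) auto
  then show 1: "34 \<le> fibi (m - 1)" by (simp add: numeral_eq_Suc)
  have "luci m = fibi m + 2 * fibi (m - 1)"
    using luci_fibi[of m] assms fibi_Suc_Suc[of "m - 1"] by simp
  with 1 show "fibi m + 4 < luci m" by simp
  have "lucas 2 \<le> lucas (m - 2)" using assms by (intro lucas_mono) auto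
  then show "2 < luci (m - 2)" by (simp add: numeral_eq_Suc)
qed

text \<open>Here r is k modulo 2m and j = n - k. Folding indices modulo L_m replaces the difference
  by one of a signed Lucas and a signed Fibonacci number. Where their sizes add up to less than L_m,
  divisibility forces the two to be equal, which \<open>lucas_eq_fib\<close> or the sizes of the
  numbers rule out.\<close>

lemma lucas_dvd_imp:
  assumes m: "10 \<le> m" and r: "r < 2 * m" and j: "m - 1 \<le> j" "j \<le> m + 3"
    and dvd: "luci m dvd luci (r + j) - fibi r"
  shows "r = 0 \<and> j = m"
proof (rule ccontr)
  assume ne: "\<not> (r = 0 \<and> j = m)"
  note b = fib_less_lucas[OF m]
  have sgn: "(-1) ^ n = (1::int) \<or> (-1) ^ n = (-1::int)" for n :: nat
    by (cases "even n") auto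
  have Lm: "luci m = luci (m - 1) + luci (m - 2)"
    using m lucas.simps(3)[of "m - 2"] by (simp add: numeral_2_eq_2 Suc_diff_Suc)
  have L1: "3 < luci (m - 1)"
  proof -
    have "lucas 3 \<le> lucas (m - 1)" using m by (intro lucas_mono) auto
    then show ?thesis by (simp add: numeral_eq_Suc)
  qed
  show False
  proof (cases "r \<le> m")
    case rm: True
    consider "r + j < m" | "r + j = m" | t where "r + j = m + t" "1 \<le> t" "t \<le> m - 1"
      | i where "r + j = 2 * m + i" "i \<le> 3"
    proof -
      have "r + j \<le> 2 * m + 3" using rm j by simp
      then have "r + j < m \<or> r + j = m \<or> (r + j = m + (r + j - m) \<and> 1 \<le> r + j - m \<and> r + j - m \<le> m - 1)
          \<or> (r + j = 2 * m + (r + j - 2 * m) \<and> r + j - 2 * m \<le> 3)" by linarith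
      then show thesis using that by blast
    qed
    then show False
    proof cases
      case 1
      then have "r = 0" "r + j = m - 1" using j m by auto
      then have "luci m dvd luci (m - 1)" using dvd by simp
      then show False using zdvd_imp_le[of "luci m" "luci (m - 1)"] Lm b L1 by simp
    next
      case 2
      then have "r = 1" using ne j m by auto
      then have "fibi r = 1" by simp
      with dvd have "luci m dvd luci m - 1" by (simp only: 2)
      then have "luci m dvd luci m - (luci m - 1)" by (rule dvd_diff[OF dvd_refl])
      then show False using b by simp
    next
      case (3 t)
      have "luci (r + j) - fibi r = luci m * luci t - ((-1) ^ t * luci (m - t) + fibi r)"
        using luci_reflect[of t m] 3 by simp
      then have "(-1) ^ t * luci (m - t) - (- fibi r) = luci m * luci t - (luci (r + j) - fibi r)"
        by simp
      then have d: "luci m dvd (-1) ^ t * luci (m - t) - (- fibi r)"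
        using dvd_diff[OF dvd_triv_left dvd, of "luci t"] by (simp only:)
      \<comment> \<open>From j >= m - 1 follows r <= t + 1. With u = m - t - 1, L_m = L_u F_t +
        L_{u+1} F_{t+1}; the first product is at least 2 and the second at least L_{u+1} + F_{t+1} -
        1.\<close>
      have "luci (m - t) + fibi r < luci m"
      proof -
        have rt: "fibi r \<le> fibi (Suc t)" using 3 j by (intro of_nat_mono fib_mono) auto
        define u where "u = m - t - 1"
        have u: "m - t = Suc u" "m = u + Suc t" using 3 m by (auto simp: u_def)
        have "luci m = luci u * fibi (Suc (Suc t)) + (luci (Suc u) - luci u) * fibi (Suc t)"
          unfolding u(2) by (rule luci_add)
        then have e: "luci m = luci u * fibi t + luci (Suc u) * fibi (Suc t)"
          by (simp add: algebra_simps)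
        have p: "1 \<le> luci (Suc u)" "1 \<le> luci u" "1 \<le> fibi t" "1 \<le> fibi (Suc t)"
          using lucas_pos[of u] lucas_pos[of "Suc u"] 3
          by (auto simp: Suc_le_eq fib_neq_0_nat simp del: lucas.simps fib.simps)
        have "0 \<le> (luci (Suc u) - 1) * (fibi (Suc t) - 1)" using p by simp
        then have "luci (Suc u) + fibi (Suc t) - 1 \<le> luci (Suc u) * fibi (Suc t)"
          by (simp add: algebra_simps)
        moreover have "2 \<le> luci u * fibi t"
        proof (cases "t \<le> 2")
          case True
          then have "lucas 2 \<le> lucas u" using m u by (intro lucas_mono) auto
          then have "3 \<le> luci u" by (simp add: numeral_eq_Suc)
          then have "3 * 1 \<le> luci u * fibi t" using p by (intro mult_mono) auto
          then show ?thesis by simp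
        next
          case False
          then have "fib 3 \<le> fib t" by (intro fib_mono) auto
          then have "2 \<le> fibi t" by (simp add: numeral_eq_Suc)
          then have "1 * 2 \<le> luci u * fibi t" using p by (intro mult_mono) auto
          then show ?thesis by simp
        qed
        ultimately show ?thesis using e rt u by simp
      qed
      then have "\<bar>luci (m - t)\<bar> = \<bar>- fibi r\<bar>"
        by (intro not_dvd_small[OF d sgn]) simp
      then have "lucas (m - t) = fib r" by simp
      then have "m - t \<le> 2" "r \<le> 4" using lucas_eq_fib by blast+
      then show False using 3 j m by linarith
    next
      case (4 i)
      have "luci (r + j) - fibi r = luci m * luci (m + i) - ((-1) ^ m * luci i - (- fibi r))"
        using luci_double_add[of m i] 4 by simp
      then have "(-1) ^ m * luci i - (- fibi r) = luci m * luci (m + i) - (luci (r + j) - fibi r)"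
        by simp
      then have d: "luci m dvd (-1) ^ m * luci i - (- fibi r)"
        using dvd_diff[OF dvd_triv_left dvd, of "luci (m + i)"] by (simp only:)
      have "i \<in> {0, 1, 2, 3}" using 4 by auto
      then have i: "luci i \<le> 4" by (auto simp: numeral_eq_Suc)
      have "fib r \<le> fib m" using rm by (rule fib_mono)
      then have "\<bar>luci i\<bar> = \<bar>- fibi r\<bar>"
        using i b by (intro not_dvd_small[OF d sgn]) simp
      moreover have "fib 7 \<le> fib r" using 4 j m by (intro fib_mono) linarith
      then have "13 \<le> fibi r" by (simp add: numeral_eq_Suc)
      ultimately show False using i by simp
    qed
  next
    case False
    \<comment> \<open>Now both indices are folded: F_r becomes (-1)^s F_{m-s} and L_{2m+u} becomes
      -(-1)^m L_u. The cases follow the size of u, which is at most m + 2.\<close>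
    define s where "s = r - m"
    have s: "r = m + s" "1 \<le> s" "s \<le> m - 1" using False r by (auto simp: s_def)
    define u where "u = s + j - m"
    have u: "r + j = 2 * m + u" "s + j = m + u" using s j m by (auto simp: u_def)
    have "luci (r + j) - fibi r = luci m * luci (m + u) - luci m * fibi s
        - ((-1) ^ m * luci u + (-1) ^ s * fibi (m - s))"
    proof -
      have "s \<le> m" using s by simp
      then have "fibi r = luci m * fibi s + (-1) ^ s * fibi (m - s)"
        unfolding s(1) by (rule fibi_reflect)
      then show ?thesis unfolding u(1) luci_double_add by simp
    qed
    then have "(-1) ^ m * luci u - (- ((-1) ^ s * fibi (m - s)))
        = luci m * (luci (m + u) - fibi s) - (luci (r + j) - fibi r)"
      by (simp add: algebra_simps)
    then have d1: "luci m dvd (-1) ^ m * luci u - (- ((-1) ^ s * fibi (m - s)))"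
      using dvd_diff[OF dvd_triv_left dvd, of "luci (m + u) - fibi s"] by (simp only:)
    have d: "\<bar>luci u\<bar> = \<bar>fibi (m - s)\<bar>" if "\<bar>luci u\<bar> + \<bar>fibi (m - s)\<bar> < luci m"
      using not_dvd_small[OF d1 sgn] that by (simp add: abs_mult)
    consider "u \<le> 3" | "4 \<le> u" "u \<le> m - 1" | "u = m" | "u = m + 1 \<or> u = m + 2"
    proof -
      have "u \<le> m + 2" using s j by (simp add: u_def)
      then show thesis using that by linarith
    qed
    then show False
    proof cases
      case 1
      have "u \<in> {0, 1, 2, 3}" using 1 by auto
      then have i: "luci u \<le> 4" by (auto simp: numeral_eq_Suc)
      have "fib (m - s) \<le> fib m" by (intro fib_mono) auto
      then have "\<bar>luci u\<bar> = \<bar>fibi (m - s)\<bar>" using i b by (intro d) simp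
      then have "lucas u = fib (m - s)" by simp
      then have "u \<le> 2" "m - s \<le> 4" using lucas_eq_fib by blast+
      then show False using u j m by linarith
    next
      case 2
      \<comment> \<open>Since j <= m + 3, m - s <= v + 3. The bound on L_u + F_{v+3} comes from L_m
        = L_u F_{v+1} + L_{u-1} F_v with L_u >= 7 and L_{u-1} >= 4.\<close>
      define v where "v = m - u"
      have v: "m = u + v" "1 \<le> v" using 2 m by (auto simp: v_def)
      obtain u' where u': "u = Suc u'" using 2 by (cases u) auto
      have "m - s \<le> v + 3" using u j v by linarith
      then have f: "fibi (m - s) \<le> fibi (Suc (Suc (Suc v)))"
        by (intro of_nat_mono fib_mono) auto
      have "lucas 4 \<le> lucas u" "lucas 3 \<le> lucas u'" using 2 u' by (auto intro!: lucas_mono)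
      then have l: "7 \<le> luci u" "4 \<le> luci u'" by (simp_all add: numeral_eq_Suc)
      have fv: "1 \<le> fibi v" "1 \<le> fibi (Suc v)"
        using v by (auto simp: Suc_le_eq fib_neq_0_nat simp del: fib.simps)
      have "luci m = luci u * fibi (Suc v) + (luci (Suc u) - luci u) * fibi v"
        unfolding v(1) by (rule luci_add)
      then have e: "luci m = luci u * fibi (Suc v) + luci u' * fibi v"
        by (simp add: u')
      have "0 \<le> (luci u - 7) * (fibi (Suc v) - 1)" "0 \<le> (luci u' - 4) * fibi v"
        using l fv by simp_all
      then have "luci u + 7 * fibi (Suc v) - 7 + 4 * fibi v \<le> luci m"
        unfolding e by (simp add: algebra_simps)
      moreover have "fibi (Suc (Suc (Suc v))) = 2 * fibi (Suc v) + fibi v" by simp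
      ultimately have "luci u + fibi (m - s) < luci m" using f fv by linarith
      then have "lucas u = fib (m - s)" using d by simp
      then have "u \<le> 2" using lucas_eq_fib by blast
      then show False using 2 by simp
    next
      case 3
      \<comment> \<open>L_u = L_m vanishes modulo L_m, so L_m would divide F_{m-s}, which is 1 or
        2.\<close>
      have "m - s \<le> 3" using u 3 j by linarith
      then have "fib (m - s) \<le> fib 3" by (intro fib_mono)
      then have f: "fibi (m - s) \<le> 2" "0 < fibi (m - s)"
        using s m by (simp_all add: numeral_eq_Suc fib_neq_0_nat)
      have "luci m dvd (-1) ^ m * luci u" using 3 by simp
      then have "luci m dvd (-1) ^ m * luci u - ((-1) ^ m * luci u - (- ((-1) ^ s * fibi (m - s))))"
        using d1 by (rule dvd_diff)
      then have "luci m dvd - ((-1) ^ s * fibi (m - s))" by simp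
      then have "luci m dvd fibi (m - s)" using sgn[of s] by auto
      then show False using f zdvd_imp_le[of "luci m" "fibi (m - s)"] Lm L1 b by simp
    next
      case 4
      have "m - s \<le> 3" using u 4 j by linarith
      then have "fib (m - s) \<le> fib 3" by (intro fib_mono)
      then have f: "fibi (m - s) \<le> 2" "0 < fibi (m - s)"
        using s m by (simp_all add: numeral_eq_Suc fib_neq_0_nat)
      have L: "luci (m + 1) = luci m + luci (m - 1)" "luci (m + 2) = 2 * luci m + luci (m - 1)"
        using lucas.simps(3)[of "m - 1"] m by simp_all
      \<comment> \<open>Both L_{m+1} and L_{m+2} are congruent to L_{m-1} modulo L_m, and L_{m-1} >
        3 exceeds F_{m-s}.\<close>
      obtain c where c: "luci u = c * luci m + luci (m - 1)"
      proof (cases "u = m + 1")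
        case True
        then show ?thesis using that[of 1] L by simp
      next
        case False
        then show ?thesis using that[of 2] L 4 by simp
      qed
      have "(-1) ^ m * luci u - (- ((-1) ^ s * fibi (m - s)))
          = luci m * ((-1) ^ m * c) + ((-1) ^ m * luci (m - 1) - (- ((-1) ^ s * fibi (m - s))))"
        unfolding c by (simp add: algebra_simps)
      with d1 have "luci m dvd luci m * ((-1) ^ m * c)
          + ((-1) ^ m * luci (m - 1) - (- ((-1) ^ s * fibi (m - s))))" by (simp only:)
      then have d2: "luci m dvd (-1) ^ m * luci (m - 1) - (- ((-1) ^ s * fibi (m - s)))"
        by (simp only: dvd_add_right_iff[OF dvd_triv_left])
      have "\<bar>luci (m - 1)\<bar> = \<bar>- ((-1) ^ s * fibi (m - s))\<bar>"
        using f b Lm by (intro not_dvd_small[OF d2 sgn]) (simp add: abs_mult)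
      then show False using f L1 by (simp add: abs_mult)
    qed
  qed
qed

section \<open>Primes congruent to 3 modulo 4 and the case of even q and D\<close>

text \<open>If a prime factor is 1 modulo 4, its cofactor is again 3 modulo 4, and the induction
  continues with the cofactor.\<close>

lemma three_mod_four_prime_divisor:
  fixes n :: nat
  assumes "n mod 4 = 3"
  shows "\<exists>p. prime p \<and> p dvd n \<and> p mod 4 = 3"
  using assms
proof (induction n rule: less_induct)
  case (less n)
  obtain p where p: "prime p" "p dvd n"
    using less.prems prime_factor_nat[of n] by force
  then obtain k where k: "n = p * k" by auto
  have "odd n" using less.prems by presburger
  then have odd: "odd p" "odd k" unfolding k by simp_all
  show ?case
  proof (cases "p mod 4 = 3")
    case False
    then have p1: "p mod 4 = 1" using odd(1) by presburger
    have "(p * k) mod 4 = k mod 4"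
      using mod_mult_left_eq[of p 4 k] p1 by simp
    then have k3: "k mod 4 = 3" using less.prems k by simp
    moreover have "k < n" using k k3 p(1) prime_gt_1_nat[of p] by (cases "k = 0") auto
    ultimately obtain r where "prime r" "r dvd k" "r mod 4 = 3" using less.IH by blast
    then show ?thesis using k by (metis dvd_mult)
  qed (use p in blast)
qed

text \<open>For odd h = (p - 1)/2, raising y^2 = -1 to the power h gives y^(p-1) = -1 modulo p,
  against Fermat's little theorem.\<close>

lemma three_mod_four_not_dvd:
  fixes p y :: nat
  assumes "prime p" "p mod 4 = 3"
  shows "\<not> p dvd y ^ 2 + 1"
proof
  assume d: "p dvd y ^ 2 + 1"
  define h where "h = (p - 1) div 2"
  have h: "p - 1 = 2 * h" "odd h"
  proof -
    have "p = 4 * (p div 4) + 3" using assms(2) mult_div_mod_eq[of 4 p] by simp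
    then obtain i where "p = 4 * i + 3" by blast
    then show "p - 1 = 2 * h" "odd h" unfolding h_def by auto
  qed
  have "\<not> p dvd y"
  proof
    assume "p dvd y"
    then have "p dvd y ^ 2" by (simp add: power2_eq_square)
    then have "p dvd (y ^ 2 + 1) - y ^ 2" using d by (intro dvd_diff_nat)
    then have "p dvd 1" by simp
    then show False using assms(1) by simp
  qed
  then have 1: "[y ^ (p - 1) = 1] (mod p)" by (rule fermat_theorem[OF assms(1)])
  have "[int y ^ 2 = -1] (mod int p)"
  proof -
    have "int p dvd int (y ^ 2 + 1)" using d by (simp only: int_dvd_int_iff)
    then show ?thesis by (simp add: cong_iff_dvd_diff add.commute)
  qed
  then have "[(int y ^ 2) ^ h = (-1) ^ h] (mod int p)" by (rule cong_pow)
  then have "[int y ^ (p - 1) = -1] (mod int p)" using h by (simp add: power_mult)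
  moreover have "[int y ^ (p - 1) = 1] (mod int p)"
    using cong_int_iff[of "y ^ (p - 1)" 1 p] 1 by simp
  ultimately have "int p dvd (int y ^ (p - 1) - (-1)) - (int y ^ (p - 1) - 1)"
    unfolding cong_iff_dvd_diff by (rule dvd_diff)
  then have "int p dvd int 2" by simp
  then have "p dvd 2" by (simp only: int_dvd_int_iff)
  then have "p \<le> 2" by (rule dvd_imp_le) simp
  then have "p = 0 \<or> p = 1 \<or> p = 2" by linarith
  then show False using assms(2) by auto
qed

lemma lucas_pow2_mod_4: "lucas (2 ^ Suc a) mod 4 = 3"
proof (induction a)
  case (Suc a)
  have "luci (2 ^ Suc (Suc a)) = luci (2 ^ Suc a) * luci (2 ^ Suc a) - 2"
    using luci_double_add[of "2 ^ Suc a" 0] by simp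
  moreover have "luci (2 ^ Suc a) mod 4 = 3" using arg_cong[OF Suc, of int] by (simp add: zmod_int)
  moreover have "(x * x - 2) mod 4 = 3" if x: "x mod 4 = 3" for x :: int
  proof -
    have "x = 4 * (x div 4) + 3" using x mult_div_mod_eq[of 4 x] by simp
    then obtain t where "x = 4 * t + 3" by blast
    then have "x * x - 2 = 3 + 4 * (4 * t * t + 6 * t + 1)" by (simp add: algebra_simps)
    then show ?thesis by presburger
  qed
  ultimately have "luci (2 ^ Suc (Suc a)) mod 4 = 3" by simp
  then have "int (lucas (2 ^ Suc (Suc a)) mod 4) = int 3" by (simp add: zmod_int)
  then show ?case by (simp only: of_nat_eq_iff)
next
  case 0
  have "lucas 2 = 3" by (simp add: numeral_2_eq_2)
  then show ?case by simp
qed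

lemma lucas_dvd_odd_multiple: "luci h dvd luci (h * (2 * i + 1))"
proof (induction i)
  case (Suc i)
  have "h * (2 * Suc i + 1) = 2 * h + h * (2 * i + 1)" by simp
  then have "luci (h * (2 * Suc i + 1))
      = luci h * luci (h + h * (2 * i + 1)) - (-1) ^ h * luci (h * (2 * i + 1))"
    by (simp only: luci_double_add)
  then show ?case using Suc.IH by simp
qed simp

lemma ex_pow2_odd: "0 < N \<Longrightarrow> \<exists>a l. N = 2 ^ a * l \<and> odd l" for N :: nat
proof (induction N rule: less_induct)
  case (less N)
  show ?case
  proof (cases "even N")
    case True
    then obtain M where M: "N = 2 * M" by blast
    then obtain a l where "M = 2 ^ a * l" "odd l" using less.IH[of M] less.prems by auto
    then have "N = 2 ^ Suc a * l" using M by simp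
    then show ?thesis using \<open>odd l\<close> by blast
  next
    case False
    then have "N = 2 ^ 0 * N" by simp
    then show ?thesis using False by blast
  qed
qed

lemma even_even_impossible:
  fixes x :: nat
  assumes "luci (m + 2 * m * q) = luci m * int (x ^ 2) + fibi (2 * m * q)"
    and "even q" "0 < q" "0 < m"
  shows False
proof -
  define N where "N = m * q"
  have N: "even N" "0 < N" using assms by (auto simp: N_def)
  \<comment> \<open>As N is even, the reflected term is -L_m; moved to the other side it turns x^2
    into x^2 + 1.\<close>
  have "luci (2 * N + m) = luci N * luci (N + m) - luci m"
    using luci_double_add[of N m] N by simp
  moreover have "fibi (2 * N) = luci N * fibi N" by (rule fibi_double)
  moreover have "luci (2 * N + m) = luci m * int (x ^ 2) + fibi (2 * N)"
    using assms(1) by (simp add: N_def add.commute mult.assoc)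
  ultimately have e: "luci m * int (x ^ 2 + 1) = luci N * (luci (N + m) - fibi N)"
    by (simp add: algebra_simps)
  \<comment> \<open>The odd cofactor l makes L_{2^a} divide L_N, and a >= 1 makes L_{2^a} congruent
    to 3 modulo 4.\<close>
  obtain a l where al: "N = 2 ^ a * l" "odd l"
    using ex_pow2_odd[OF N(2)] by blast
  then obtain a' where a': "a = Suc a'" using N(1) by (cases a) auto
  obtain i where l: "l = 2 * i + 1" using al(2) oddE by blast
  obtain p where p: "prime p" "p dvd lucas (2 ^ a)" "p mod 4 = 3"
    using three_mod_four_prime_divisor[OF lucas_pow2_mod_4[of a']] a' by blast
  have pN: "int p dvd luci N"
  proof -
    have "int p dvd luci (2 ^ a)" using p(2) by (simp only: int_dvd_int_iff)
    also have "luci (2 ^ a) dvd luci N"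
      using lucas_dvd_odd_multiple[of "2 ^ a" i] al l by simp
    finally show ?thesis .
  qed
  have podd: "\<not> p dvd 4"
  proof
    assume "p dvd 4"
    then have "p dvd 2 ^ 2" by simp
    then have "p dvd 2" using p(1) prime_dvd_power by blast
    then have "p = 2" using p(1) by (metis primes_dvd_imp_eq two_is_prime_nat)
    then show False using p(3) by simp
  qed
  \<comment> \<open>As q is even, 2m divides N. So p dividing L_m would divide F_{2m}, hence F_N,
    and with L_N also L_N^2 - 5 F_N^2 = 4.\<close>
  have "\<not> int p dvd luci m"
  proof
    assume "int p dvd luci m"
    then have "int p dvd fibi (2 * m)" by (simp add: fibi_double)
    moreover have "2 * m dvd N" using assms(2) by (auto simp: N_def)
    then have "fib (2 * m) dvd fib N" by (metis fib_gcd gcd_nat.absorb_iff1)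
    then have "fibi (2 * m) dvd fibi N" by (simp only: int_dvd_int_iff)
    ultimately have "int p dvd fibi N" by (rule dvd_trans)
    then have "int p dvd luci N * luci N - 5 * (fibi N * fibi N)" using pN by simp
    then have "int p dvd int 4" using luci_sq[of N] N by simp
    then show False using podd by (simp only: int_dvd_int_iff)
  qed
  moreover have "int p dvd luci m * int (x ^ 2 + 1)" unfolding e using pN by simp
  ultimately have "int p dvd int (x ^ 2 + 1)"
    using p(1) prime_dvd_mult_iff[of "int p" "luci m" "int (x ^ 2 + 1)"] by simp
  then have "p dvd x ^ 2 + 1" by (simp only: int_dvd_int_iff)
  then show False using three_mod_four_not_dvd[OF p(1,3)] by blast
qed

subsection \<open>Size estimates\<close>

lemma num_digits_bounds:
  assumes "2 \<le> b" "0 < N"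
  shows "N < b ^ num_digits b N" "b ^ num_digits b N \<le> b * N"
proof -
  obtain n where n: "b ^ n \<le> N" "N < b ^ (n + 1)"
    using ex_power_ivl1[of b N] assms by auto
  then have "\<lfloor>log (real b) (real N)\<rfloor> = int n"
    by (intro floor_log_nat_eq_if assms)
  then have "num_digits b N = n + 1" using assms by (simp add: num_digits_def)
  then show "N < b ^ num_digits b N" "b ^ num_digits b N \<le> b * N" using n by auto
qed

lemma fib_20: "fib 20 = 6765" and fib_19: "fib 19 = 4181"
proof -
  have "fib_seq 0 1 21 ! 20 = 6765" "fib_seq 0 1 21 ! 19 = 4181" by code_simp+
  then show "fib 20 = 6765" "fib 19 = 4181"
    using fib_seq_fib[of 20 21 0] fib_seq_fib[of 19 21 0] by simp_all
qed

lemma lucas_9: "lucas 9 = 76" and lucas_13: "lucas 13 = 521" and lucas_32: "lucas 32 = 4870847"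
proof -
  have "fib_seq 2 1 33 ! 9 = 76" "fib_seq 2 1 33 ! 13 = 521" "fib_seq 2 1 33 ! 32 = 4870847"
    by code_simp+
  then show "lucas 9 = 76" "lucas 13 = 521" "lucas 32 = 4870847"
    using fib_seq_lucas[of 9 33 0] fib_seq_lucas[of 13 33 0] fib_seq_lucas[of 32 33 0] by simp_all
qed

text \<open>Below: L_{m-2+k} = L_{m-2} F_{k-1} + L_{m-1} F_k <= L_m F_k < L_n. Above: L_{m+4+k} =
  L_{m+4} F_{k-1} + L_{m+5} F_k with F_{k-1} >= F_k / 2 exceeds (10 L_m + 1) F_k.\<close>

lemma lucas_index_range:
  assumes m: "10 \<le> m" and k: "2 \<le> k" and eq: "luci n = luci m * x + fibi k"
    and x: "fibi k < x" "x \<le> 10 * fibi k"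
  shows "m - 1 + k \<le> n" "n \<le> m + 3 + k"
proof -
  obtain l where l: "k = Suc (Suc l)" using k by (metis add_2_eq_Suc le_Suc_ex)
  have Lm: "3 \<le> luci m"
  proof -
    have "lucas 2 \<le> lucas m" using m by (intro lucas_mono) auto
    then show ?thesis by (simp add: numeral_2_eq_2)
  qed
  have f: "0 < fibi (Suc l)" "fibi k \<le> 2 * fibi (Suc l)" "fibi (Suc l) \<le> fibi k"
    "fibi (Suc k) - fibi k = fibi (Suc l)"
    using fib_mono[of l "Suc l"] by (auto simp: l fib_neq_0_nat)
  have lo: "luci m * fibi k < luci m * x" and hi: "luci m * x \<le> luci m * (10 * fibi k)"
    using x Lm by (simp_all add: mult_left_mono)
  show "n \<le> m + 3 + k"
  proof (rule ccontr)
    assume "\<not> n \<le> m + 3 + k"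
    then have "lucas (m + 4 + k) \<le> lucas n" by (intro lucas_mono) auto
    then have "luci (m + 4 + k) \<le> luci n" by simp
    moreover have "luci (m + 4 + k)
        = luci (m + 4) * fibi (Suc k) + (luci (Suc (m + 4)) - luci (m + 4)) * fibi k"
      by (rule luci_add)
    then have "luci (m + 4 + k) = luci (m + 4) * fibi (Suc l) + luci (Suc (m + 4)) * fibi k"
      using f(4) by (simp add: algebra_simps)
    moreover have "luci (m + 4) = 3 * luci (Suc m) + 2 * luci m"
      "luci (Suc (m + 4)) = 5 * luci (Suc m) + 3 * luci m"
      by (simp_all add: numeral_eq_Suc)
    moreover have "luci m < luci (Suc m)" using lucas_less_Suc[of m] m by simp
    moreover have "luci (m + 4) * fibi k \<le> luci (m + 4) * (2 * fibi (Suc l))"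
      using f by (intro mult_left_mono) auto
    moreover have "(20 * luci m + 2) * fibi k < (2 * luci (Suc (m + 4)) + luci (m + 4)) * fibi k"
      using calculation f Lm by (intro mult_strict_right_mono) auto
    then have "20 * (luci m * fibi k) + 2 * fibi k < 2 * (luci (Suc (m + 4)) * fibi k) + luci (m + 4) * fibi k"
      by (simp add: algebra_simps)
    ultimately show False using eq hi by (simp add: algebra_simps)
  qed
  show "m - 1 + k \<le> n"
  proof (rule ccontr)
    assume "\<not> m - 1 + k \<le> n"
    then have "n \<le> m - 2 + k" using m by linarith
    then have "lucas n \<le> lucas (m - 2 + k)" using m by (intro lucas_mono') auto
    then have "luci n \<le> luci (m - 2 + k)" by simp
    moreover have "luci (m - 2 + k)
        = luci (m - 2) * fibi (Suc k) + (luci (Suc (m - 2)) - luci (m - 2)) * fibi k"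
      by (rule luci_add)
    then have "luci (m - 2 + k) = luci (m - 2) * fibi (Suc l) + luci (Suc (m - 2)) * fibi k"
      using f(4) by (simp add: algebra_simps)
    moreover have "luci (m - 2) * fibi (Suc l) \<le> luci (m - 2) * fibi k"
      using f by (intro mult_left_mono) auto
    moreover have "luci m = luci (m - 2) + luci (Suc (m - 2))"
      using m lucas.simps(3)[of "m - 2"] by (simp add: numeral_2_eq_2 Suc_diff_Suc)
    then have "luci m * fibi k = luci (m - 2) * fibi k + luci (Suc (m - 2)) * fibi k"
      by (simp add: algebra_simps)
    ultimately show False using eq lo f by linarith
  qed
qed

text \<open>The bound 6765 is \<open>F\<^bsub>20\<^esub>\<close>, so that \<open>g\<^sup>D > F\<^sub>k\<close> and \<open>k \<ge> 20\<close> give \<open>D \<ge> E\<close>.\<close>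

definition sieved :: "nat \<Rightarrow> nat \<Rightarrow> int \<Rightarrow> bool" where
  "sieved g E B \<longleftrightarrow> 2 \<le> g \<and> g ^ (E - 1) \<le> 6765 \<and> B \<le> 10 \<and>
     (\<exists>ss. sieve multiple_test (int g) E ss 1 1 1 (Class 0 0 0)) \<and> (\<exists>ss. small_sieve (int g) E B ss)"

lemma sieved_exponent:
  assumes "sieved g E B" "20 \<le> k" "fibi k < int g ^ D"
  shows "E \<le> D"
proof (rule ccontr)
  assume "\<not> E \<le> D"
  then have "g ^ D \<le> g ^ (E - 1)"
    using assms by (intro power_increasing) (auto simp: sieved_def)
  also have "\<dots> \<le> fib 20" using assms by (simp add: sieved_def fib_20)
  also have "\<dots> \<le> fib k" using assms by (intro fib_mono)
  finally have "int (g ^ D) \<le> fibi k" by (simp only: of_nat_le_iff)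
  then show False using assms(3) by simp
qed

lemma no_solution_large_m:
  assumes s: "sieved g E B" and m: "10 \<le> m" and k: "2 \<le> k"
    and eq: "luci n = luci m * int g ^ D + fibi k"
    and x: "fibi k < int g ^ D" "int g ^ D \<le> B * fibi k"
  shows False
proof -
  have "B * fibi k \<le> 10 * fibi k" using s by (intro mult_right_mono) (auto simp: sieved_def)
  then have x': "int g ^ D \<le> 10 * fibi k" using x by linarith
  note r = lucas_index_range[OF m k eq x(1) x']
  define j where "j = n - k"
  have n: "n = k + j" "m - 1 \<le> j" "j \<le> m + 3" using r by (auto simp: j_def)
  define q where "q = k div (2 * m)"
  define t where "t = k mod (2 * m)"
  have kq: "k = 2 * m * q + t" "t < 2 * m" using m by (auto simp: q_def t_def)
  have "luci m dvd luci n - fibi k" using eq by simp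
  moreover have "n = 2 * m * q + (t + j)" using kq n by simp
  ultimately have "luci m dvd luci (t + j) - fibi t"
    using cong_sub_period[of m q "t + j" t] kq by simp
  then have tj: "t = 0" "j = m" using lucas_dvd_imp[OF m kq(2) n(2,3)] by auto
  have q: "0 < q" using kq tj k by (cases q) auto
  \<comment> \<open>This is the bound from which \<open>sieved_exponent\<close> obtains E <=
    D.\<close>
  have k20: "20 \<le> k"
  proof -
    have "2 * 10 * 1 \<le> 2 * m * q" using m q by (intro mult_le_mono) auto
    then show ?thesis using kq tj by simp
  qed
  have eq': "luci (m + 2 * m * q) = luci m * int g ^ D + fibi (2 * m * q)"
    using eq n kq tj by (simp add: add.commute)
  show False
  proof (cases "even q \<and> even D")
    case True
    then obtain h where "D = 2 * h" by auto
    then have "int g ^ D = int ((g ^ h) ^ 2)" by (simp add: power_mult[symmetric] mult.commute)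
    then show False using even_even_impossible[of m q "g ^ h"] eq' True q m by simp
  next
    case False
    obtain ss where "sieve multiple_test (int g) E ss 1 1 1 (Class 0 0 0)" using s by (auto simp: sieved_def)
    then show False
      using multiple_sieve_sound[of "int g" E ss D q m] sieved_exponent[OF s k20 x(1)] False eq' by blast
  qed
qed

lemma no_solution_small_m:
  assumes s: "sieved g E B" and m: "m < 10" and k: "20 \<le> k"
    and eq: "luci n = luci m * int g ^ D + fibi k"
    and x: "fibi k < int g ^ D" "int g ^ D \<le> B * fibi k"
  shows False
proof -
  obtain i where "k = 20 + i" using k le_iff_add by blast
  then obtain l where l: "k = Suc (Suc l)" by simp
  have f: "0 < fibi k" using k by (simp add: fib_neq_0_nat)
  have "B * fibi k \<le> 10 * fibi k" using s by (intro mult_right_mono) (auto simp: sieved_def)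
  then have x': "int g ^ D \<le> 10 * fibi k" using x by linarith
  have "lucas m \<le> lucas 9" using m by (intro lucas_mono') auto
  then have L: "luci m \<le> 76" "1 \<le> luci m" using lucas_pos[of m] by (simp_all add: lucas_9)
  have "luci m * int g ^ D \<le> 76 * (10 * fibi k)" using L x' x f by (intro mult_mono) auto
  then have hi: "luci n \<le> 761 * fibi k" using eq by linarith
  have "1 * int g ^ D \<le> luci m * int g ^ D" using L by (intro mult_right_mono) auto
  then have lo: "2 * fibi k < luci n" using eq x(1) by linarith
  have "k \<le> n"
  proof (rule ccontr)
    assume "\<not> k \<le> n"
    then have "lucas n \<le> lucas (Suc l)" using l k by (intro lucas_mono') auto
    moreover have "lucas (Suc l) = fib k + fib l" using lucas_as_fib[of l] l by simp
    moreover have "fib l \<le> fib k" using l by (intro fib_mono) auto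
    ultimately show False using lo by linarith
  qed
  then obtain j where n: "n = k + j" using le_iff_add by blast
  \<comment> \<open>Otherwise L_n >= L_{k+14} >= L_13 F_{k+2} >= 521 * 2 F_k, against L_n <= (76 *
    10 + 1) F_k.\<close>
  have "j < 14"
  proof (rule ccontr)
    assume "\<not> j < 14"
    then have "lucas (13 + Suc k) \<le> lucas n" using n by (intro lucas_mono) auto
    then have "luci (13 + Suc k) \<le> luci n" by simp
    moreover have "luci (13 + Suc k) = luci 13 * fibi (Suc (Suc k)) + (luci (Suc 13) - luci 13) * fibi (Suc k)"
      by (rule luci_add)
    moreover have "luci (Suc 13) - luci 13 = luci 12" using lucas.simps(3)[of 12] by simp
    then have "0 \<le> (luci (Suc 13) - luci 13) * fibi (Suc k)" by simp
    moreover have "fibi k \<le> fibi (Suc k)" using fib_mono[of k "Suc k"] by simp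
    then have "2 * fibi k \<le> fibi (Suc (Suc k))" by simp
    ultimately show False using hi f by (simp add: lucas_13)
  qed
  obtain ss where "small_sieve (int g) E B ss" using s by (auto simp: sieved_def)
  then show False
    using small_sieve_sound[of "int g" E B ss D m j k] sieved_exponent[OF s k x(1)] m \<open>j < 14\<close> k eq n x
    by simp
qed

section \<open>The case F_k = 0 and the finite search\<close>

text \<open>Put u = L_{m-3} and v = L_{m-2}. Size leaves n - m in {1, 2, 3, 4}, and each pair of n -
  m and b gives a homogeneous linear equation in u and v without solution for 0 < u < v <
  2u.\<close>

lemma no_solution_fib_zero:
  assumes "10 \<le> m" "2 \<le> b" "b \<le> 10"
  shows "lucas n \<noteq> lucas m * b"
proof
  assume eq: "lucas n = lucas m * b"
  define l where "l = m - 3"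
  define u v where "u = lucas l" "v = lucas (Suc l)"
  have m: "m = Suc (Suc (Suc l))" using assms(1) by (simp add: l_def)
  have uv: "u < v" "0 < u" using assms(1) lucas_less_Suc[of l] lucas_pos[of l]
    by (auto simp: u_v_def l_def)
  have "v < 2 * u"
  proof -
    define i where "i = l - 2"
    have "l = Suc (Suc i)" using assms(1) by (simp add: i_def l_def)
    then show ?thesis using lucas_pos[of i] by (simp add: u_v_def)
  qed
  have vals: "lucas m = 2 * v + u" "lucas (m + 1) = 3 * v + 2 * u" "lucas (m + 2) = 5 * v + 3 * u"
    "lucas (m + 3) = 8 * v + 5 * u" "lucas (m + 4) = 13 * v + 8 * u" "lucas (m + 5) = 21 * v + 13 * u"
    by (simp_all add: m u_v_def numeral_eq_Suc)
  have "m < n"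
  proof (rule ccontr)
    assume "\<not> m < n"
    then have "lucas n \<le> lucas m" using assms by (intro lucas_mono') auto
    moreover have "lucas m * 2 \<le> lucas m * b" using assms by (intro mult_left_mono) auto
    ultimately show False using eq lucas_pos[of m] by linarith
  qed
  moreover have "n < m + 5"
  proof (rule ccontr)
    assume "\<not> n < m + 5"
    then have "lucas (m + 5) \<le> lucas n" by (intro lucas_mono) auto
    moreover have "lucas m * b \<le> lucas m * 10" using assms by (intro mult_left_mono) auto
    ultimately show False using eq uv by (simp add: vals)
  qed
  ultimately have "n = m + 1 \<or> n = m + 2 \<or> n = m + 3 \<or> n = m + 4" by linarith
  moreover have "b = 2 \<or> b = 3 \<or> b = 4 \<or> b = 5 \<or> b = 6 \<or> b = 7 \<or> b = 8 \<or> b = 9 \<or> b = 10"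
    using assms by linarith
  ultimately show False
    using eq vals uv \<open>v < 2 * u\<close> by (elim disjE) simp_all
qed

fun hits :: "(nat \<times> int) list \<Rightarrow> int \<Rightarrow> nat \<Rightarrow> nat \<Rightarrow> nat \<Rightarrow> nat \<Rightarrow> bool" where
  "hits [] v m k b d = True"
| "hits ((n, l) # NT) v m k b d =
     (if l = v then (if (n, m, k, b, d) \<in> sols then hits NT v m k b d else False) else hits NT v m k b d)"

lemma hitsD: "hits NT v m k b d \<Longrightarrow> (n, v) \<in> set NT \<Longrightarrow> (n, m, k, b, d) \<in> sols"
  by (induction NT v m k b d rule: hits.induct) (auto split: if_splits)

text \<open>The digit count enters without logarithms: for k > 0 through f < b^d <= b f, for k = 0
  through the convention that 0 has one digit.\<close>

fun base_row :: "(nat \<times> int) list \<Rightarrow> (nat \<times> int) list \<Rightarrow> nat \<Rightarrow> nat \<Rightarrow> int \<Rightarrow> nat \<Rightarrow> int \<Rightarrow> bool" where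
  "base_row NT MT b d x k f =
     (if (if k = 0 then d = 1 else f < x \<and> x \<le> int b * f)
      then list_all (\<lambda>(m, l). hits NT (l * x + f) m k b d) MT else True)"

fun base_rows :: "(nat \<times> int) list \<Rightarrow> (nat \<times> int) list \<Rightarrow> (nat \<times> int) list \<Rightarrow> nat \<Rightarrow> nat \<Rightarrow> int \<Rightarrow> bool" where
  "base_rows NT MT KT b d x = list_all (\<lambda>(k, f). base_row NT MT b d x k f) KT"

definition base_check :: "(nat \<times> int) list \<Rightarrow> (nat \<times> int) list \<Rightarrow> (nat \<times> int) list \<Rightarrow> bool" where
  "base_check NT MT KT =
     list_all (\<lambda>b. list_all (\<lambda>d. base_rows NT MT KT b d (int b ^ d)) [1..<14]) [2..<11]"

lemma base_check_holds:
  "base_check (zip [0..<32] (fib_seq 2 1 32)) (zip [0..<10] (fib_seq 2 1 10))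
     (zip [0..<20] (fib_seq 0 1 20))"
  by code_simp

lemma sols_sound: "\<forall>(n, m, k, b, d)\<in>sols. lucas n = lucas m * b ^ d + fib k"
  by code_simp

text \<open>The table sizes suffice: F_k <= F_19 = 4181 gives b^(d-1) <= 4181 < 2^13, hence d < 14.
  Moreover b^d <= 41810 and L_m <= 76, so L_n <= 76 * 41810 + 4181 < L_32.\<close>

lemma small_solutions:
  assumes b: "2 \<le> b" "b \<le> 10" and d: "d = num_digits b (fib k)" and k: "k < 20" and m: "m < 10"
    and eq: "lucas n = lucas m * b ^ d + fib k"
  shows "(n, m, k, b, d) \<in> sols"
proof -
  have d1: "d = 1" if "k = 0" using d that by (simp add: num_digits_def)
  have bd: "fib k < b ^ d" "b ^ d \<le> b * fib k" if "k \<noteq> 0"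
    using num_digits_bounds[of b "fib k"] b d that by (auto simp: fib_neq_0_nat)
  have fk: "fib k \<le> 4181" using fib_mono[of k 19] k by (simp add: fib_19)
  have x: "b ^ d \<le> b * 4181"
  proof (cases "k = 0")
    case False
    have "b * fib k \<le> b * 4181" using fk by (intro mult_left_mono) auto
    then show ?thesis using bd(2)[OF False] by linarith
  qed (use d1 in simp)
  have d0: "1 \<le> d" unfolding d num_digits_def by simp
  have "d < 14"
  proof (rule ccontr)
    assume "\<not> d < 14"
    obtain e where e: "d = Suc e" using d0 by (cases d) auto
    have "(2::nat) ^ 13 \<le> 2 ^ e" using \<open>\<not> d < 14\<close> e by (intro power_increasing) auto
    also have "\<dots> \<le> b ^ e" using b by (intro power_mono) auto
    also have "\<dots> \<le> 4181" using x b e by simp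
    finally show False by simp
  qed
  have "lucas m \<le> 76" using lucas_mono'[of m 9] m by (simp add: lucas_9)
  moreover have "b * 4181 \<le> 10 * 4181" using b by (intro mult_right_mono) auto
  then have "b ^ d \<le> 41810" using x by simp
  ultimately have "lucas m * b ^ d \<le> 76 * 41810" by (intro mult_le_mono)
  then have "lucas n < lucas 32" using eq fk by (simp add: lucas_32)
  then have n: "n < 32" by (cases "2 \<le> n") (auto dest: lucas_less_imp)
  have "hits (zip [0..<32] (fib_seq 2 1 32)) (luci m * int b ^ d + fibi k) m k b d"
  proof -
    have bb: "b \<in> set [2..<11]" and dd: "d \<in> set [1..<14]" using b d0 \<open>d < 14\<close> by auto
    have 1: "base_row (zip [0..<32] (fib_seq 2 1 32)) (zip [0..<10] (fib_seq 2 1 10)) b d (int b ^ d) k (fibi k)"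
      using bspec[OF bspec[OF bspec[OF base_check_holds[unfolded base_check_def base_rows.simps
        list_all_iff] bb] dd] fibi_in_fib_seq[OF k]] by (simp only: prod.case)
    have "if k = 0 then d = 1 else fibi k < int b ^ d \<and> int b ^ d \<le> int b * fibi k"
      using d1 bd by (simp flip: of_nat_power of_nat_mult)
    then have "list_all (\<lambda>(m, l). hits (zip [0..<32] (fib_seq 2 1 32)) (l * int b ^ d + fibi k) m k b d)
         (zip [0..<10] (fib_seq 2 1 10))"
      using 1 unfolding base_row.simps by (simp only: if_True)
    from bspec[OF this[unfolded list_all_iff] luci_in_fib_seq[OF m]] show ?thesis by simp
  qed
  moreover have "luci n = luci m * int b ^ d + fibi k" using arg_cong[OF eq, of int] by simp
  ultimately show ?thesis using hitsD luci_in_fib_seq[OF n] by metis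
qed

subsection \<open>Certificates\<close>

text \<open>
  The step lists were found by a computer search. The large moduli at their ends remove solutions
  with a negative index, which survive every sieve that does not see the size of the exponent:
  for instance \<open>L\<^bsub>-12\<^esub> = 7\<^sup>2 L\<^bsub>-4\<^esub> + F\<^bsub>-8\<^esub>\<close> for \<open>g = 7\<close>, or \<open>3\<^sup>2 L\<^sub>6 = L\<^bsub>-6\<^esub> - F\<^bsub>-12\<^esub>\<close> for \<open>g = 3\<close>.
\<close>

lemma sievedI:
  assumes "2 \<le> g" "g ^ (E - 1) \<le> 6765" "B \<le> 10"
    and "sieve multiple_test (int g) E ss 1 1 1 (Class 0 0 0)" "small_sieve (int g) E B ss'"
  shows "sieved g E B"
  using assms unfolding sieved_def by blast

text \<open>13 is the largest E with 2^(E-1) <= 6765; the exponents for the other g are maximal in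
  the same way.\<close>

lemma multiple_certificate_2: "sieve multiple_test (int 2) 13 [
      Lift 1 2 2, Par, Lift 8 1 1, Pow 3 8 2, Lift 1 2 1, Pow 3 8 2, Lift 3 1 1, Van 16 24,
      Lift 1 3 1, Van 16 24, Lift 2 1 1, Van 32 48, Lift 1 2 1, Van 32 48, Lift 1 1 3,
      Pow 9 24 6, Pow 7 16 3]
    1 1 1 (Class 0 0 0)"
  by code_simp

lemma small_certificate_2: "small_sieve (int 2) 13 8 [
      Lift 8 1 2, Pow 3 8 2, Lift 3 1 1, Van 16 24, Lift 1 1 3, Pow 9 24 6, Lift 2 1 1,
      Van 32 48, Pow 7 16 3, Lift 5 1 2, Pow 5 20 4, Lift 1 1 5, Pow 31 30 5, Pow 11 10 10]"
  by code_simp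

lemma sieved_2: "sieved 2 13 8"
  by (rule sievedI[OF _ _ _ multiple_certificate_2 small_certificate_2]) simp_all

lemma multiple_certificate_3: "sieve multiple_test (int 3) 9 [
      Lift 8 1 1, Van 3 8, Lift 1 4 1, Van 3 8, Lift 3 1 1, Van 9 24, Lift 1 3 1, Pow 2 3 1,
      Van 9 24, Lift 1 1 2, Pow 8 12 2, Par, Lift 2 1 3, Pow 7 16 6, Lift 3 1 1, Van 27 72,
      Lift 1 1 3, Pow 19 18 18, Lift 5 1 2, Pow 5 20 4, Lift 1 5 1, Pow 5 20 4, Lift 1 1 5,
      Pow 31 30 30, Lift 9 18 1, Van 243 648, Pow 1621 810 45]
    1 1 1 (Class 0 0 0)"
  by code_simp

lemma small_certificate_3: "small_sieve (int 3) 9 9 [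
      Lift 8 1 1, Van 3 8, Lift 3 1 2, Pow 8 12 2, Van 9 24, Lift 2 1 3, Pow 7 16 6, Lift 1 1 2,
      Pow 16 24 4, Lift 5 1 1, Pow 5 20 4, Lift 1 1 5, Pow 31 30 30, Lift 3 1 1, Van 27 72,
      Lift 1 1 3, Pow 19 18 18, Lift 3 1 1, Van 81 216, Lift 1 1 3, Pow 109 108 27, Lift 3 1 1,
      Van 243 648, Pow 1621 810 45]"
  by code_simp

lemma sieved_3: "sieved 3 9 9"
  by (rule sievedI[OF _ _ _ multiple_certificate_3 small_certificate_3]) simp_all

lemma multiple_certificate_5: "sieve multiple_test (int 5) 6 [
      Lift 20 2 1, Van 5 20, Lift 1 5 1, Van 5 20, Lift 1 1 5, Pow 11 10 5, Lift 3 3 1,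
      Pow 4 6 1, Lift 1 1 3, Pow 31 30 3, Lift 1 1 2, Pow 8 12 2, Pow 61 60 30, Par, Lift 2 1 1,
      Pow 9 24 6, Lift 1 1 2, Pow 16 24 4, Pow 41 40 20, Lift 5 5 1, Van 25 100, Pow 601 600 12]
    1 1 1 (Class 0 0 0)"
  by code_simp

lemma small_certificate_5: "small_sieve (int 5) 6 5 [
      Lift 8 1 2, Pow 3 8 2, Lift 3 1 1, Pow 8 12 2, Lift 1 1 3, Pow 9 24 6, Lift 2 1 1,
      Pow 7 16 6, Lift 1 1 2, Pow 16 24 4, Lift 5 1 1, Van 5 20, Pow 31 30 3, Lift 1 1 5,
      Pow 41 40 20, Lift 5 1 1, Van 25 100, Pow 601 600 12, Lift 3 1 15, Pow 19 18 9, Lift 5 1 1,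
      Pow 251 250 25, Lift 5 1 5, Van 625 2500, Pow 11251 11250 1125]"
  by code_simp

lemma sieved_5: "sieved 5 6 5"
  by (rule sievedI[OF _ _ _ multiple_certificate_5 small_certificate_5]) simp_all

lemma multiple_certificate_6: "sieve multiple_test (int 6) 5 [
      Lift 1 2 2, Par, Lift 8 1 1, Van 3 8, Lift 1 2 1, Van 3 8, Lift 3 1 1, Van 16 24,
      Lift 1 3 1, Van 16 24, Lift 2 1 1, Van 32 48, Pow 7 16 2, Lift 1 2 1, Van 32 48,
      Pow 7 16 2, Lift 5 1 6, Pow 31 30 6, Lift 1 5 1, Pow 5 20 1, Pow 31 30 6]
    1 1 1 (Class 0 0 0)"
  by code_simp

lemma small_certificate_6: "small_sieve (int 6) 5 6 [
      Lift 8 1 1, Van 3 8, Lift 3 1 2, Van 16 24, Van 9 24, Lift 2 1 1, Van 32 48, Pow 7 16 2,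
      Lift 5 1 6, Pow 31 30 6]"
  by code_simp

lemma sieved_6: "sieved 6 5 6"
  by (rule sievedI[OF _ _ _ multiple_certificate_6 small_certificate_6]) simp_all

text \<open>The \<open>Coarse\<close> steps drop factors of the moduli and so merge classes before
  further lifts by 7, which reach the modulus 7^4 = 2401.\<close>

lemma multiple_certificate_7: "sieve multiple_test (int 7) 5 [
      Lift 1 2 2, Par, Lift 3 3 1, Pow 2 3 1, Lift 2 1 1, Pow 4 6 2, Lift 2 1 1, Pow 8 12 2,
      Lift 2 1 1, Pow 16 24 2, Lift 1 2 1, Pow 16 24 2, Pow 3 8 1, Lift 2 1 1, Van 7 16,
      Lift 1 1 2, Pow 32 48 4, Lift 1 1 3, Pow 9 24 3, Lift 5 1 1, Pow 5 20 4, Lift 1 5 1,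
      Pow 5 20 4, Lift 1 1 5, Pow 31 30 15, Pow 11 10 10, Pow 61 60 60, Lift 1 1 2, Pow 41 40 40,
      Lift 2 1 1, Pow 64 96 8, Lift 1 2 1, Pow 64 96 8, Van 7 16, Lift 3 3 1, Pow 19 18 3,
      Pow 181 90 12, Lift 1 1 3, Pow 27 72 9, Pow 541 90 90, Coarse 720 18 180, Lift 7 4 1,
      Pow 13 28 12, Lift 1 7 1, Pow 13 28 12, Van 49 112, Lift 1 1 7, Pow 29 14 7,
      Coarse 1008 126 90, Lift 7 7 1, Van 343 784, Lift 7 7 1, Van 2401 5488, Pow 154351 6174 90]
    1 1 1 (Class 0 0 0)"
  by code_simp

lemma small_certificate_7: "small_sieve (int 7) 5 7 [
      Lift 8 1 1, Pow 3 8 1, Lift 3 1 1, Pow 2 3 1, Lift 1 1 2, Pow 16 24 2, Lift 2 1 1,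
      Van 7 16, Lift 1 1 3, Pow 9 24 3, Lift 1 1 2, Pow 32 48 4, Lift 5 1 1, Pow 5 20 4,
      Lift 1 1 5, Pow 31 30 15, Lift 2 1 2, Pow 64 96 8, Pow 41 40 40, Lift 3 1 1, Pow 19 18 3,
      Lift 1 1 3, Pow 27 72 9, Lift 7 1 1, Pow 13 28 12, Van 49 112]"
  by code_simp

lemma sieved_7: "sieved 7 5 7"
  by (rule sievedI[OF _ _ _ multiple_certificate_7 small_certificate_7]) simp_all

lemma multiple_certificate_10: "sieve multiple_test (int 10) 4 [
      Lift 1 2 2, Par, Lift 8 2 1, Pow 3 8 1, Lift 3 1 1, Van 16 24, Lift 1 3 1, Van 16 24,
      Pow 9 24 1]
    1 1 1 (Class 0 0 0)"
  by code_simp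

lemma small_certificate_10: "small_sieve (int 10) 4 10 [
      Lift 8 1 1, Pow 3 8 1, Lift 3 1 2, Van 16 24, Pow 9 24 1, Lift 2 1 3, Pow 7 16 6,
      Lift 5 1 2, Van 5 20, Pow 11 10 2, Lift 1 1 5, Pow 31 30 15]"
  by code_simp

lemma sieved_10: "sieved 10 4 10"
  by (rule sievedI[OF _ _ _ multiple_certificate_10 small_certificate_10]) simp_all

section \<open>From certificates to all bases\<close>

text \<open>The certificates for g = 2 and g = 3 were run with B = 8 and B = 9, so they also cover
  the bases 4, 8 and 9, with D = 2d or 3d.\<close>

lemma ex_sieved_base:
  assumes "2 \<le> b" "b \<le> 10"
  shows "\<exists>g D E B. b ^ d = g ^ D \<and> sieved g E B \<and> int b \<le> B"
proof -
  have pow: "4 ^ d = (2::nat) ^ (2 * d)" "8 ^ d = (2::nat) ^ (3 * d)" "9 ^ d = (3::nat) ^ (2 * d)"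
    by (simp_all add: power_mult)
  have "\<exists>D. b ^ d = 2 ^ D" if "b = 2 \<or> b = 4 \<or> b = 8"
    using that pow(1,2) by metis
  moreover have "\<exists>D. b ^ d = 3 ^ D" if "b = 3 \<or> b = 9"
    using that pow(3) by metis
  moreover have "b = 2 \<or> b = 3 \<or> b = 4 \<or> b = 5 \<or> b = 6 \<or> b = 7 \<or> b = 8 \<or> b = 9 \<or> b = 10"
    using assms by linarith
  ultimately consider D where "b ^ d = 2 ^ D" "b \<le> 8" | D where "b ^ d = 3 ^ D" "b \<le> 9"
    | "b = 5" | "b = 6" | "b = 7" | "b = 10"
    by fastforce
  then show ?thesis
  proof cases
    case (1 D)
    then show ?thesis using sieved_2 by (intro exI[of _ 2] exI[of _ D] exI[of _ 13] exI[of _ 8]) simp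
  next
    case (2 D)
    then show ?thesis using sieved_3 by (intro exI[of _ 3] exI[of _ D] exI[of _ 9] exI[of _ 9]) simp
  next
    case 3
    then show ?thesis using sieved_5 by (intro exI[of _ 5] exI[of _ d] exI[of _ 6] exI[of _ 5]) simp
  next
    case 4
    then show ?thesis using sieved_6 by (intro exI[of _ 6] exI[of _ d] exI[of _ 5] exI[of _ 6]) simp
  next
    case 5
    then show ?thesis using sieved_7 by (intro exI[of _ 7] exI[of _ d] exI[of _ 5] exI[of _ 7]) simp
  next
    case 6
    then show ?thesis using sieved_10 by (intro exI[of _ 10] exI[of _ d] exI[of _ 4] exI[of _ 10]) simp
  qed
qed

theorem theorem1p1:
  fixes n m k b d :: nat
  assumes "2 \<le> b" and "b \<le> 10" and "d = num_digits b (fib k)"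
  shows "lucas n = lucas m * b ^ d + fib k \<longleftrightarrow> (n, m, k, b, d) \<in> sols"
proof
  note b = assms(1,2) and d = assms(3)
  assume eq: "lucas n = lucas m * b ^ d + fib k"
  show "(n, m, k, b, d) \<in> sols"
  \<comment> \<open>Outside the search box, three cases remain: k = 0 with m >= 10, m < 10 with k >=
    20, and m >= 10 with k positive.\<close>
  proof (cases "k < 20 \<and> m < 10")
    case True
    then show ?thesis using small_solutions[OF b d _ _ eq] by blast
  next
    case False
    have "False"
    proof (cases "k = 0")
      case True
      then have "d = 1" using d by (simp add: num_digits_def)
      then show False using no_solution_fib_zero[of m b n] b eq True False by simp
    next
      case k0: False
      \<comment> \<open>Since F_1 = F_2, the index 1 is replaced by 2, the least index
        \<open>no_solution_large_m\<close> admits.\<close>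
      define k' where "k' = (if k = 1 then 2 else k)"
      have k': "fib k' = fib k" "2 \<le> k'" "k < 20 \<longleftrightarrow> k' < 20" using k0 by (auto simp: k'_def numeral_2_eq_2)
      obtain g D E B where g: "b ^ d = g ^ D" "sieved g E B" "int b \<le> B" using ex_sieved_base[OF b] by blast
      have bd: "fib k < b ^ d" "b ^ d \<le> b * fib k"
        using num_digits_bounds[of b "fib k"] b d k0 by (auto simp: fib_neq_0_nat)
      have x: "int g ^ D = int (b ^ d)" using g(1) by simp
      have 1: "fibi k' < int g ^ D" unfolding x k' using bd(1) by (simp only: of_nat_less_iff)
      have "int (b ^ d) \<le> int (b * fib k)" using bd(2) by (simp only: of_nat_le_iff)
      also have "\<dots> \<le> B * fibi k" using g(3) by (simp add: mult_right_mono)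
      finally have 2: "int g ^ D \<le> B * fibi k'" unfolding x k' .
      have 3: "luci n = luci m * int g ^ D + fibi k'"
        unfolding x k' using arg_cong[OF eq, of int] by simp
      show False
      proof (cases "m < 10")
        case True
        then show False using no_solution_small_m[OF g(2) True _ 3 1 2] False k' by simp
      next
        case False
        then show False using no_solution_large_m[OF g(2) _ k'(2) 3 1 2] by simp
      qed
    qed
    then show ?thesis ..
  qed
next
  assume "(n, m, k, b, d) \<in> sols"
  then show "lucas n = lucas m * b ^ d + fib k" using sols_sound by blast
qed

end
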